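(* Let $G=(V,E)$ be a connected, locally finite, quasi-transitive graph. Then for every $0<p<p_{2\to 2}(G)$ there exist positive constants $c_p,C_p$ and $\lambda_p$ such that $$\mathbf P_p\left(\sup_{v\in K_u\setminus\{u\}}\frac{d_{\mathrm{int}}(u,v)}{d(u,v)}\geq\lambda\right)\leq C_pe^{-c_p\lambda}$$ for every $u\in V$ and $\lambda\geq 1$, and similarly $$\mathbf P_p\bigl(d_{\mathrm{int}}(u,v)\geq n\mid u\leftrightarrow v\bigr)\leq C_pe^{-c_pn}$$ for every $u,v\in V$ and every integer $n\ge 0$ with $n\geq\lambda_p\,d(u,v)$.
   Context: $G$ is quasi-transitive if the action of $\operatorname{Aut}(G)$ on $V$ has finitely many orbits. Bernoulli-$p$ bond percolation on $G$: each edge is independently open with probability $p$ and closed otherwise; $G[p]$ is the subgraph of open edges, its connected components are called clusters, its law is $\mathbf P_p$, $K_u$ is the cluster of $u$, and $u\leftrightarrow v$ means $u,v$ are in the same cluster. $d$ is the graph distance on $G$ and $d_{\mathrm{int}}$ is the graph distance on $G[p]$, with $d_{\mathrm{int}}(u,v)=\infty$ if $u,v$ are in different clusters. The supremum over the empty set is taken to be $0$. $T_p(u,v)=\mathbf P_p(u\leftrightarrow v)$; for $M\in[0,\infty]^{V^2}$, $\|M\|_{q\to q}=\sup\{\|Mf\|_q/\|f\|_q: f\in L^q(V), f\ge0, f\ne0\}$ (counting measure); $p_{2\to2}(G)=\sup\{p\in[0,1]:\|T_p\|_{2\to2}<\infty\}$. *)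

theory Defs
  imports "HOL-Probability.Probability"
begin

section \<open>Graphs\<close>

definition simple_graph :: "'a set \<Rightarrow> 'a set set \<Rightarrow> bool" where
  "simple_graph V E \<longleftrightarrow> (\<forall>e\<in>E. e \<subseteq> V \<and> card e = 2)"

definition adj_rel :: "'a set set \<Rightarrow> ('a \<times> 'a) set" where
  "adj_rel F = {(x, y). {x, y} \<in> F}"

definition connected_graph :: "'a set \<Rightarrow> 'a set set \<Rightarrow> bool" where
  "connected_graph V E \<longleftrightarrow> V \<noteq> {} \<and> (\<forall>u\<in>V. \<forall>v\<in>V. (u, v) \<in> (adj_rel E)\<^sup>*)"

definition locally_finite_graph :: "'a set \<Rightarrow> 'a set set \<Rightarrow> bool" where
  "locally_finite_graph V E \<longleftrightarrow> (\<forall>v\<in>V. finite {e\<in>E. v \<in> e})"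

text \<open>An automorphism is only constrained on \<open>V\<close>; its values outside \<open>V\<close> are arbitrary
  and play no role for the orbits.\<close>

definition graph_automorphism :: "'a set \<Rightarrow> 'a set set \<Rightarrow> ('a \<Rightarrow> 'a) \<Rightarrow> bool" where
  "graph_automorphism V E \<phi> \<longleftrightarrow>
     bij_betw \<phi> V V \<and> (\<forall>x\<in>V. \<forall>y\<in>V. {\<phi> x, \<phi> y} \<in> E \<longleftrightarrow> {x, y} \<in> E)"

definition aut_orbit :: "'a set \<Rightarrow> 'a set set \<Rightarrow> 'a \<Rightarrow> 'a set" where
  "aut_orbit V E v = {\<phi> v |\<phi>. graph_automorphism V E \<phi>}"

definition quasi_transitive :: "'a set \<Rightarrow> 'a set set \<Rightarrow> bool" where
  "quasi_transitive V E \<longleftrightarrow> finite (aut_orbit V E ` V)"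

text \<open>The distance is the least number of edges of a walk from \<open>u\<close> to \<open>v\<close> using edges in
  \<open>F\<close>. The infimum of the empty set is \<open>\<infinity>\<close>, so it is infinite between different components.\<close>

definition graph_dist :: "'a set set \<Rightarrow> 'a \<Rightarrow> 'a \<Rightarrow> enat" where
  "graph_dist F u v = (INF n\<in>{n. (u, v) \<in> adj_rel F ^^ n}. enat n)"


section \<open>Bernoulli bond percolation\<close>

definition percolation :: "'a set set \<Rightarrow> real \<Rightarrow> ('a set \<Rightarrow> bool) measure" where
  "percolation E p = PiM E (\<lambda>_. measure_pmf (bernoulli_pmf p))"

definition open_edges :: "'a set set \<Rightarrow> ('a set \<Rightarrow> bool) \<Rightarrow> 'a set set" where
  "open_edges E \<omega> = {e\<in>E. \<omega> e}"

definition cluster :: "'a set \<Rightarrow> 'a set set \<Rightarrow> ('a set \<Rightarrow> bool) \<Rightarrow> 'a \<Rightarrow> 'a set" where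
  "cluster V E \<omega> u = {v\<in>V. (u, v) \<in> (adj_rel (open_edges E \<omega>))\<^sup>*}"

definition int_dist :: "'a set set \<Rightarrow> ('a set \<Rightarrow> bool) \<Rightarrow> 'a \<Rightarrow> 'a \<Rightarrow> enat" where
  "int_dist E \<omega> u v = graph_dist (open_edges E \<omega>) u v"

definition two_point :: "'a set \<Rightarrow> 'a set set \<Rightarrow> real \<Rightarrow> 'a \<Rightarrow> 'a \<Rightarrow> ennreal" where
  "two_point V E p u v = ennreal (\<P>(\<omega> in percolation E p. v \<in> cluster V E \<omega> u))"


section \<open>Operator norms of nonnegative kernels\<close>

text \<open>The power \<open>x\<^sup>a\<close> for \<open>x\<close> in \<open>[0, \<infinity>]\<close> and finite \<open>a > 0\<close>.\<close>

definition ennreal_powr :: "ennreal \<Rightarrow> real \<Rightarrow> ennreal" where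
  "ennreal_powr x a = (if x = \<infinity> then \<infinity> else ennreal (enn2real x powr a))"

text \<open>The exponents \<open>q\<close> are finite, \<open>1 \<le> q < \<infinity>\<close>.\<close>

definition Lq_norm :: "real \<Rightarrow> 'a set \<Rightarrow> ('a \<Rightarrow> ennreal) \<Rightarrow> ennreal" where
  "Lq_norm q V f = ennreal_powr (\<integral>\<^sup>+ v. ennreal_powr (f v) q \<partial>count_space V) (1 / q)"

definition kernel_apply ::
    "'a set \<Rightarrow> ('a \<Rightarrow> 'a \<Rightarrow> ennreal) \<Rightarrow> ('a \<Rightarrow> real) \<Rightarrow> 'a \<Rightarrow> ennreal" where
  "kernel_apply V M f u = (\<integral>\<^sup>+ v. M u v * ennreal (f v) \<partial>count_space V)"

definition op_norm :: "real \<Rightarrow> 'a set \<Rightarrow> ('a \<Rightarrow> 'a \<Rightarrow> ennreal) \<Rightarrow> ennreal" where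
  "op_norm q V M =
     (SUP f\<in>{f :: 'a \<Rightarrow> real. (\<forall>v\<in>V. 0 \<le> f v) \<and> (\<exists>v\<in>V. f v \<noteq> 0) \<and>
                  Lq_norm q V (\<lambda>v. ennreal (f v)) < \<infinity>}.
        Lq_norm q V (kernel_apply V M f) / Lq_norm q V (\<lambda>v. ennreal (f v)))"

definition p_2_2 :: "'a set \<Rightarrow> 'a set set \<Rightarrow> real" where
  "p_2_2 V E = Sup {p. 0 \<le> p \<and> p \<le> 1 \<and> op_norm 2 V (two_point V E p) < \<infinity>}"

end

theory Submission
  imports Defs
begin

text \<open>Write \<open>tail F n u v\<close> for the probability that \<open>n \<le> d\<^sub>F(u, v) < \<infinity>\<close>, where \<open>d\<^sub>F\<close> is the
  intrinsic distance when only the edges in \<open>F\<close> are available. A geodesic of length at least \<open>i + j\<close>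
  crosses the sphere of radius \<open>j\<close>, and conditionally on the ball the rest of it lives on the
  unexplored edges; hence
  \<open>tail F (i + j) u v \<le> (\<Sum>w. P(d\<^sub>F(u, w) = j) * sup\<^bsub>F'\<^esub> tail F' i w v)\<close>.
  Take \<open>i + j = (k + 1) m\<close> with \<open>j < m\<close>, so that \<open>tail F' i \<le> tail F' (k m)\<close>, and average over \<open>j\<close>:
  the probabilities \<open>P(d\<^sub>F(u, w) = j)\<close> sum to at most the two-point function \<open>T(u, w)\<close>, so a factor
  \<open>1/m\<close> is gained at the cost of one application of \<open>T\<close>. Iterating,
  \<open>tail F (k m) u v \<le> m\<^bsup>-k\<^esup> T\<^bsup>k+1\<^esup>(u, v)\<close>, which decays exponentially in \<open>k\<close> as soon as \<open>m\<close> exceeds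
  the norm of \<open>T\<close> on \<open>L\<^sup>2\<close>. The conditional bound follows from \<open>T(u, v) \<ge> p\<^bsup>d(u, v)\<^esup>\<close>. The bound on the
  supremum is a union bound over \<open>v\<close>, which converges for large \<open>\<lambda>\<close> because \<open>\<Sum>v. p\<^bsup>2 d(u, v)\<^esup>\<close> is at
  most the sum of \<open>T(v, u)\<^sup>2\<close> over \<open>v\<close>, hence finite.\<close>

section \<open>Graph distance\<close>

lemma graph_dist_ge_iff: "enat n \<le> graph_dist F u v \<longleftrightarrow> (\<forall>k<n. (u, v) \<notin> adj_rel F ^^ k)"
  unfolding graph_dist_def le_INF_iff by (auto simp: not_less[symmetric])

lemma graph_dist_eq_iff:
  "graph_dist F u v = enat n \<longleftrightarrow> (u, v) \<in> adj_rel F ^^ n \<and> (\<forall>k<n. (u, v) \<notin> adj_rel F ^^ k)"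
proof -
  have "graph_dist F u v = enat n \<longleftrightarrow>
      enat n \<le> graph_dist F u v \<and> \<not> enat (Suc n) \<le> graph_dist F u v"
    by (cases "graph_dist F u v") auto
  then show ?thesis
    unfolding graph_dist_ge_iff by (metis less_Suc_eq)
qed

lemma graph_dist_less_iff: "graph_dist F u v < enat n \<longleftrightarrow> (\<exists>k<n. (u, v) \<in> adj_rel F ^^ k)"
  using graph_dist_ge_iff[of n F u v] by (auto simp: not_le[symmetric])

lemma graph_dist_finite_iff: "graph_dist F u v < \<infinity> \<longleftrightarrow> (u, v) \<in> (adj_rel F)\<^sup>*"
proof
  assume "graph_dist F u v < \<infinity>"
  then obtain n where "graph_dist F u v = enat n"
    by (cases "graph_dist F u v") auto
  then show "(u, v) \<in> (adj_rel F)\<^sup>*"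
    by (auto simp: graph_dist_eq_iff rtrancl_power)
next
  assume "(u, v) \<in> (adj_rel F)\<^sup>*"
  then obtain n where "(u, v) \<in> adj_rel F ^^ n"
    by (auto simp: rtrancl_power)
  then have "graph_dist F u v \<le> enat n"
    unfolding graph_dist_def by (intro INF_lower) auto
  then show "graph_dist F u v < \<infinity>"
    by (cases "graph_dist F u v") auto
qed

lemma graph_dist_leI: "(u, v) \<in> adj_rel F ^^ n \<Longrightarrow> graph_dist F u v \<le> enat n"
  unfolding graph_dist_def by (intro INF_lower) auto

lemma graph_dist_relpow:
  assumes "graph_dist F u v = enat n" shows "(u, v) \<in> adj_rel F ^^ n"
  using assms by (simp add: graph_dist_eq_iff)

lemma adj_rel_sym: "(x, y) \<in> adj_rel F \<longleftrightarrow> (y, x) \<in> adj_rel F"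
  by (simp add: adj_rel_def insert_commute)

lemma converse_adj_rel: "(adj_rel F)\<inverse> = adj_rel F"
  using adj_rel_sym[of _ _ F] by auto

lemma relpow_adj_rel_sym: "(u, v) \<in> adj_rel F ^^ n \<longleftrightarrow> (v, u) \<in> adj_rel F ^^ n"
proof -
  have "(u, v) \<in> R ^^ n \<Longrightarrow> R\<inverse> = R \<Longrightarrow> (v, u) \<in> R ^^ n" for R :: "('b \<times> 'b) set" and u v n
  proof (induction n arbitrary: v)
    case (Suc n)
    from Suc.prems(1) obtain w where w: "(u, w) \<in> R ^^ n" "(w, v) \<in> R"
      by (rule relpow_Suc_E)
    have "(v, w) \<in> R"
      using w(2) Suc.prems(2) by blast
    then show ?case
      using Suc.IH[OF w(1) Suc.prems(2)] by (rule relpow_Suc_I2)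
  qed simp
  then show ?thesis
    using converse_adj_rel by metis
qed

lemma adj_rel_mono: "F \<subseteq> F' \<Longrightarrow> adj_rel F \<subseteq> adj_rel F'"
  by (auto simp: adj_rel_def)

lemma relpow_mono': "R \<subseteq> S \<Longrightarrow> R ^^ n \<subseteq> S ^^ (n :: nat)" for R S :: "('b \<times> 'b) set"
  by (induction n) (auto intro: relcomp_mono)

lemma relpow_adj_rel_mono: "F \<subseteq> F' \<Longrightarrow> (u, v) \<in> adj_rel F ^^ n \<Longrightarrow> (u, v) \<in> adj_rel F' ^^ n"
  using relpow_mono'[OF adj_rel_mono] by blast

lemma graph_dist_antimono:
  assumes "F \<subseteq> F'"
  shows "graph_dist F' u v \<le> graph_dist F u v"
  unfolding graph_dist_def by (intro INF_superset_mono) (auto intro: relpow_adj_rel_mono[OF assms])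

section \<open>Balls, and geodesics beyond a sphere\<close>

definition touching :: "'a set set \<Rightarrow> 'a set \<Rightarrow> 'a set set" where
  "touching F S = {e \<in> F. e \<inter> S \<noteq> {}}"

text \<open>A ball is determined by the edges that meet it, hence the event that the ball is \<open>S\<close> is
  independent of the edges that avoid \<open>S\<close>.\<close>

lemma ball_local_aux:
  assumes eq: "touching F S = touching F' S"
    and S: "{x. graph_dist F u x < enat n} = S" and "k \<le> n"
  shows "(u, x) \<in> adj_rel F ^^ k \<longleftrightarrow> (u, x) \<in> adj_rel F' ^^ k"
  using \<open>k \<le> n\<close>
proof (induction k arbitrary: x)
  case (Suc k)
  have IH: "(u, y) \<in> adj_rel F ^^ k \<longleftrightarrow> (u, y) \<in> adj_rel F' ^^ k" for y
    using Suc by auto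
  have in_S: "y \<in> S" if "(u, y) \<in> adj_rel F ^^ k" for y
    using that Suc.prems unfolding S[symmetric] graph_dist_less_iff
    by (intro CollectI exI[of _ k]) auto
  have edge: "(y, x) \<in> adj_rel F \<longleftrightarrow> (y, x) \<in> adj_rel F'" if "y \<in> S" for y
  proof -
    have "{y, x} \<in> touching H S \<longleftrightarrow> {y, x} \<in> H" for H
      using that by (simp add: touching_def)
    from this[of F] this[of F'] eq show ?thesis
      by (simp add: adj_rel_def)
  qed
  show ?case
    unfolding relpow.simps relcomp_unfold using IH in_S edge by blast
qed simp

lemma ball_local:
  assumes eq: "touching F S = touching F' S"
    and S: "{x. graph_dist F u x < enat n} = S"
  shows "{x. graph_dist F' u x < enat n} = S"
    and "graph_dist F u w = enat n \<longleftrightarrow> graph_dist F' u w = enat n"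
proof -
  note aux = ball_local_aux[OF eq S]
  show "{x. graph_dist F' u x < enat n} = S"
    unfolding S[symmetric] graph_dist_less_iff using aux by (meson less_imp_le)
  show "graph_dist F u w = enat n \<longleftrightarrow> graph_dist F' u w = enat n"
    unfolding graph_dist_eq_iff using aux by (meson less_imp_le order_refl)
qed

text \<open>A geodesic from \<open>u\<close> to \<open>v\<close> meets the sphere of radius \<open>n\<close> in some vertex \<open>w\<close> and never
  returns to the ball \<open>S\<close> after that.\<close>

lemma geodesic_split:
  assumes far: "enat (i + n) \<le> graph_dist F u v" and fin: "graph_dist F u v < \<infinity>"
    and S: "S = {x. graph_dist F u x < enat n}"
  obtains w where "graph_dist F u w = enat n" "enat i \<le> graph_dist (F - touching F S) w v"
    "graph_dist (F - touching F S) w v < \<infinity>"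
proof -
  define F' where "F' = F - touching F S"
  obtain k where k: "graph_dist F u v = enat k"
    using fin by (cases "graph_dist F u v") auto
  with far have "i + n \<le> k" by simp
  from graph_dist_relpow[OF k] obtain f where f: "f 0 = u" "f k = v"
    "\<And>l. l < k \<Longrightarrow> (f l, f (Suc l)) \<in> adj_rel F"
    unfolding relpow_fun_conv by blast
  have seg: "(f a, f (a + b)) \<in> R ^^ b"
    if "\<And>l. a \<le> l \<Longrightarrow> l < a + b \<Longrightarrow> (f l, f (Suc l)) \<in> R" for a b and R
    unfolding relpow_fun_conv using that by (intro exI[of _ "\<lambda>l. f (a + l)"]) auto
  \<comment> \<open>A walk from \<open>u\<close> to \<open>f a\<close> shorter than
    \<open>a\<close>, continued along \<open>f\<close>, would be a shortcut to
    \<open>v\<close>.\<close>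
  have ge: "enat a \<le> graph_dist F u (f a)" if "a \<le> k" for a
    unfolding graph_dist_ge_iff
  proof safe
    fix l assume "l < a" "(u, f a) \<in> adj_rel F ^^ l"
    moreover have "(f a, v) \<in> adj_rel F ^^ (k - a)"
      using seg[of a "k - a" "adj_rel F"] f that by simp
    ultimately have "(u, v) \<in> adj_rel F ^^ (l + (k - a))"
      by (auto simp: relpow_add)
    then have "graph_dist F u v \<le> enat (l + (k - a))"
      by (rule graph_dist_leI)
    with k \<open>l < a\<close> that show False by simp
  qed
  have un: "graph_dist F u (f n) = enat n"
  proof (rule antisym)
    show "graph_dist F u (f n) \<le> enat n"
      using seg[of 0 n "adj_rel F"] f \<open>i + n \<le> k\<close> by (intro graph_dist_leI) auto
  qed (use ge[of n] \<open>i + n \<le> k\<close> in simp)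
  \<comment> \<open>From index \<open>n\<close> on, the vertices are at distance at least
    \<open>n\<close>, hence outside \<open>S\<close>, so no later edge touches
    \<open>S\<close>.\<close>
  have "(f l, f (Suc l)) \<in> adj_rel F'" if "n \<le> l" "l < k" for l
  proof -
    have not_S: "f a \<notin> S" if "n \<le> a" "a \<le> k" for a
    proof -
      have "enat n \<le> enat a"
        using that(1) by simp
      also note ge[OF that(2)]
      finally show ?thesis
        unfolding S by (simp add: not_less)
    qed
    show ?thesis
      using f(3)[OF that(2)] not_S[of l] not_S[of "Suc l"] that
      by (simp add: F'_def touching_def adj_rel_def)
  qed
  then have "(f n, v) \<in> adj_rel F' ^^ (k - n)"
    using seg[of n "k - n" "adj_rel F'"] f \<open>i + n \<le> k\<close> by auto
  then have "graph_dist F' (f n) v < \<infinity>"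
    unfolding graph_dist_finite_iff by (auto simp: rtrancl_power)
  \<comment> \<open>A walk from \<open>f n\<close> to \<open>v\<close> with fewer than
    \<open>i\<close> steps, prefixed by \<open>n\<close> steps from \<open>u\<close>, would
    contradict \<open>far\<close>.\<close>
  moreover have "enat i \<le> graph_dist F' (f n) v"
    unfolding graph_dist_ge_iff
  proof safe
    fix l assume "l < i" "(f n, v) \<in> adj_rel F' ^^ l"
    moreover have "F' \<subseteq> F" by (auto simp: F'_def)
    ultimately have "(f n, v) \<in> adj_rel F ^^ l"
      using relpow_adj_rel_mono by metis
    with graph_dist_relpow[OF un] have "(u, v) \<in> adj_rel F ^^ (n + l)"
      by (auto simp: relpow_add)
    then have "graph_dist F u v \<le> enat (n + l)"
      by (rule graph_dist_leI)
    with far \<open>l < i\<close> k show False by simp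
  qed
  ultimately show thesis
    using that[OF un] by (simp add: F'_def)
qed

section \<open>Finite balls, countability of the vertex set, edges of a walk\<close>

lemma simple_graph_edge: "simple_graph V E \<Longrightarrow> {x, y} \<in> E \<Longrightarrow> x \<in> V \<and> y \<in> V"
  unfolding simple_graph_def by (drule (1) bspec) simp

lemma adj_rel_subset:
  assumes "simple_graph V E" shows "adj_rel E \<subseteq> V \<times> V"
  using simple_graph_edge[OF assms] by (auto simp: adj_rel_def)

lemma relpow_adj_rel_in:
  assumes "simple_graph V E" "(u, v) \<in> adj_rel E ^^ n" "u \<in> V"
  shows "v \<in> V"
  using assms(2) adj_rel_subset[OF assms(1)] assms(3) by (cases n) auto

lemma simple_graph_subset: "simple_graph V E \<Longrightarrow> F \<subseteq> E \<Longrightarrow> simple_graph V F"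
  by (auto simp: simple_graph_def)

lemma finite_relpow_ball:
  assumes "simple_graph V E" "locally_finite_graph V E" "u \<in> V"
  shows "finite {v. (u, v) \<in> adj_rel E ^^ n}"
proof (induction n)
  case (Suc n)
  have sub: "{v. (u, v) \<in> adj_rel E ^^ Suc n} \<subseteq>
      (\<Union>w\<in>{v. (u, v) \<in> adj_rel E ^^ n}. \<Union>{e \<in> E. w \<in> e})"
    by (auto simp: adj_rel_def relcomp_unfold)
  have fin: "finite (\<Union>{e \<in> E. w \<in> e})" if "(u, w) \<in> adj_rel E ^^ n" for w
  proof (rule finite_Union)
    show "finite {e \<in> E. w \<in> e}"
      using assms relpow_adj_rel_in[OF assms(1) that] by (auto simp: locally_finite_graph_def)
    show "finite e" if "e \<in> {e \<in> E. w \<in> e}" for e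
      using that assms(1) by (auto simp: simple_graph_def intro: card_ge_0_finite)
  qed
  show ?case
    by (rule finite_subset[OF sub]) (use Suc fin in auto)
qed auto

text \<open>Connectedness exhausts \<open>V\<close> by endpoints of walks from one vertex, and local
  finiteness leaves finitely many for each length. Countability keeps unions over vertices
  measurable.\<close>

lemma countable_vertices:
  assumes "simple_graph V E" "connected_graph V E" "locally_finite_graph V E"
  shows "countable V"
proof -
  obtain u where u: "u \<in> V" "\<forall>v\<in>V. (u, v) \<in> (adj_rel E)\<^sup>*"
    using assms(2) by (auto simp: connected_graph_def)
  then have "V \<subseteq> (\<Union>n. {v. (u, v) \<in> adj_rel E ^^ n})"
    by (auto simp: rtrancl_power)
  moreover have "countable (\<Union>n. {v. (u, v) \<in> adj_rel E ^^ n})"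
    using finite_relpow_ball[OF assms(1,3) u(1)] by (auto intro: countable_finite)
  ultimately show ?thesis
    by (rule countable_subset)
qed

text \<open>A walk may repeat edges, hence only an inequality for \<open>card J\<close>. This
  reduces the lower bound on connection probabilities to a finite cylinder event.\<close>

lemma walk_edges:
  assumes "(u, v) \<in> adj_rel F ^^ n"
  obtains J where "J \<subseteq> F" "finite J" "card J \<le> n" "(u, v) \<in> adj_rel J ^^ n"
proof -
  have "\<exists>J\<subseteq>F. finite J \<and> card J \<le> n \<and> (u, v) \<in> adj_rel J ^^ n"
    using assms
  proof (induction n arbitrary: v)
    case (Suc n)
    then obtain w where w: "(u, w) \<in> adj_rel F ^^ n" "{w, v} \<in> F"
      by (auto simp: adj_rel_def)
    from Suc.IH[OF w(1)] obtain J where J: "J \<subseteq> F" "finite J" "card J \<le> n" "(u, w) \<in> adj_rel J ^^ n"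
      by blast
    have "(u, w) \<in> adj_rel (insert {w, v} J) ^^ n"
      using J(4) relpow_adj_rel_mono[of J "insert {w, v} J"] by blast
    moreover have "(w, v) \<in> adj_rel (insert {w, v} J)"
      by (simp add: adj_rel_def)
    moreover have "card (insert {w, v} J) \<le> Suc n"
      using J card_insert_le_m1 by (simp add: card_insert_if)
    ultimately show ?case
      using J w by (intro exI[of _ "insert {w, v} J"]) auto
  next
    case 0
    then show ?case
      by (intro exI[of _ "{}"]) simp
  qed
  with that show thesis by blast
qed

section \<open>Product measures on the edges\<close>

text \<open>The indicator of the union is at most the sum of the indicators, and a countable sum
  commutes with the integral. Writing the sum over \<open>count_space I\<close> avoids enumerating
  vertices or balls.\<close>

lemma emeasure_UN_countable_le:
  assumes "countable I" and [measurable]: "\<And>i. i \<in> I \<Longrightarrow> X i \<in> sets M"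
  shows "emeasure M (\<Union>i\<in>I. X i) \<le> (\<integral>\<^sup>+i. emeasure M (X i) \<partial>count_space I)"
proof -
  have [measurable]: "(\<Union>i\<in>I. X i) \<in> sets M"
    using assms by (intro sets.countable_UN') auto
  have "emeasure M (\<Union>i\<in>I. X i) = (\<integral>\<^sup>+x. indicator (\<Union>i\<in>I. X i) x \<partial>M)"
    by simp
  also have "\<dots> \<le> (\<integral>\<^sup>+x. (\<integral>\<^sup>+i. indicator (X i) x \<partial>count_space I) \<partial>M)"
  proof (intro nn_integral_mono)
    fix x
    show "indicator (\<Union>i\<in>I. X i) x \<le> (\<integral>\<^sup>+i. indicator (X i) x \<partial>count_space I)"
    proof (cases "\<exists>i\<in>I. x \<in> X i")
      case True
      then obtain i where i: "i \<in> I" "x \<in> X i" by blast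
      have "(1 :: ennreal) = indicator (X i) x" using i by simp
      also have "\<dots> \<le> (\<integral>\<^sup>+i. indicator (X i) x \<partial>count_space I)"
        using i(1) by (rule nn_integral_ge_point)
      finally show ?thesis by (simp add: indicator_def)
    qed auto
  qed
  also have "\<dots> = (\<integral>\<^sup>+i. (\<integral>\<^sup>+x. indicator (X i) x \<partial>M) \<partial>count_space I)"
    using assms by (intro nn_integral_count_space_nn_integral) auto
  also have "\<dots> = (\<integral>\<^sup>+i. emeasure M (X i) \<partial>count_space I)"
    by (intro nn_integral_cong) auto
  finally show ?thesis .
qed

text \<open>Both parameters stay general: conditioning uses products over parts of the edge set, and
  coupling puts a pair of bits on each edge.\<close>

abbreviation bond_space :: "'a set set \<Rightarrow> 'b pmf \<Rightarrow> ('a set \<Rightarrow> 'b) measure" where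
  "bond_space J q \<equiv> PiM J (\<lambda>_. measure_pmf q)"

lemma prob_space_bond_space: "prob_space (bond_space J q)"
  by (intro prob_space_PiM measure_pmf.prob_space_axioms)

text \<open>The joint law of the coordinates is the product of their marginals. That criterion for
  independence is applied to a nonempty index set, hence the separate case.\<close>

lemma indep_vars_bond_space:
  "prob_space.indep_vars (bond_space J q) (\<lambda>_. measure_pmf q) (\<lambda>e \<omega>. \<omega> e) J"
proof -
  interpret prob_space "bond_space J q" by (rule prob_space_bond_space)
  show ?thesis
  proof (cases "J = {}")
    case True
    show ?thesis
      unfolding indep_vars_def indep_sets_def using True by simp
  next
    case False
    have "distr (bond_space J q) (bond_space J q) (\<lambda>\<omega>. \<lambda>e\<in>J. \<omega> e) =
        distr (bond_space J q) (bond_space J q) (\<lambda>\<omega>. \<omega>)"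
      by (intro distr_cong) (auto simp: space_PiM PiE_def extensional_restrict)
    also have "\<dots> = bond_space J q"
      by (rule distr_id)
    also have "\<dots> = PiM J (\<lambda>e. distr (bond_space J q) (measure_pmf q) (\<lambda>\<omega>. \<omega> e))"
      by (intro PiM_cong refl distr_PiM_component[symmetric] measure_pmf.prob_space_axioms)
    finally show ?thesis
      by (subst indep_vars_iff_distr_eq_PiM') (use False in auto)
  qed
qed

text \<open>Functions of independent coordinates are independent, so the joint law is again a
  product. For empty \<open>J\<close> both sides are the counting measure on one
  configuration.\<close>

lemma distr_bond_space:
  fixes f :: "'c \<Rightarrow> 'b" and J :: "'a set set"
  shows
  "distr (bond_space J q) (bond_space J (map_pmf f q)) (\<lambda>\<omega>. \<lambda>e\<in>J. f (\<omega> e)) =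
   bond_space J (map_pmf f q)"
proof (cases "J = {}")
  case True
  have "distr (count_space {a}) (count_space {b}) (\<lambda>_. b) = count_space {b}"
    for a :: "'a set \<Rightarrow> 'c" and b :: "'a set \<Rightarrow> 'b"
  proof (rule measure_eqI)
    fix A assume "A \<in> sets (distr (count_space {a}) (count_space {b}) (\<lambda>_. b))"
    then consider "A = {}" | "A = {b}" by (auto simp: subset_singleton_iff)
    then show "emeasure (distr (count_space {a}) (count_space {b}) (\<lambda>_. b)) A = emeasure (count_space {b}) A"
      by cases (simp_all add: emeasure_distr)
  qed simp
  then show ?thesis
    unfolding True PiM_empty by (simp add: restrict_def)
next
  case False
  interpret prob_space "bond_space J q" by (rule prob_space_bond_space)
  have f[measurable]: "f \<in> measurable (measure_pmf q) (measure_pmf (map_pmf f q))"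
    by simp
  have "indep_vars (\<lambda>_. measure_pmf (map_pmf f q)) (\<lambda>e \<omega>. f (\<omega> e)) J"
    by (rule indep_vars_compose2[OF indep_vars_bond_space]) simp
  moreover have "random_variable (measure_pmf (map_pmf f q)) (\<lambda>\<omega>. f (\<omega> e))" if "e \<in> J" for e
    using that by measurable
  ultimately have "distr (bond_space J q) (bond_space J (map_pmf f q)) (\<lambda>\<omega>. \<lambda>e\<in>J. f (\<omega> e)) =
      PiM J (\<lambda>e. distr (bond_space J q) (measure_pmf (map_pmf f q)) (\<lambda>\<omega>. f (\<omega> e)))"
    using False by (subst (asm) indep_vars_iff_distr_eq_PiM') auto
  also have "\<dots> = bond_space J (map_pmf f q)"
  proof (intro PiM_cong refl)
    fix e assume "e \<in> J"
    then have meas: "(\<lambda>\<omega>. \<omega> e) \<in> measurable (bond_space J q) (measure_pmf q)"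
      by measurable
    have "distr (bond_space J q) (measure_pmf (map_pmf f q)) (\<lambda>\<omega>. f (\<omega> e)) =
        distr (distr (bond_space J q) (measure_pmf q) (\<lambda>\<omega>. \<omega> e)) (measure_pmf (map_pmf f q)) f"
      by (subst distr_distr[OF f meas]) (simp add: comp_def)
    also have "distr (bond_space J q) (measure_pmf q) (\<lambda>\<omega>. \<omega> e) = measure_pmf q"
      using \<open>e \<in> J\<close> by (intro distr_PiM_component measure_pmf.prob_space_axioms)
    also have "distr (measure_pmf q) (measure_pmf (map_pmf f q)) f = measure_pmf (map_pmf f q)"
      by (auto simp: map_pmf_rep_eq intro!: distr_cong)
    finally show "distr (bond_space J q) (measure_pmf (map_pmf f q)) (\<lambda>\<omega>. f (\<omega> e)) =
        measure_pmf (map_pmf f q)" .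
  qed
  finally show ?thesis .
qed

text \<open>Restrictions of an independent family to disjoint index sets are independent. Later
  \<open>J\<close> consists of the edges of \<open>F\<close> that meet a ball and \<open>K\<close>
  of the other edges of \<open>F\<close>.\<close>

lemma bond_space_indep:
  assumes "A \<in> sets (bond_space J q)" "B \<in> sets (bond_space K q)"
    and "J \<inter> K = {}" "J \<subseteq> L" "K \<subseteq> L"
  shows "emeasure (bond_space L q) {\<omega> \<in> space (bond_space L q). restrict \<omega> J \<in> A \<and> restrict \<omega> K \<in> B} =
    emeasure (bond_space L q) {\<omega> \<in> space (bond_space L q). restrict \<omega> J \<in> A} *
    emeasure (bond_space L q) {\<omega> \<in> space (bond_space L q). restrict \<omega> K \<in> B}"
proof -
  interpret prob_space "bond_space L q" by (rule prob_space_bond_space)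
  have "indep_var (bond_space J q) (\<lambda>\<omega>. restrict \<omega> J) (bond_space K q) (\<lambda>\<omega>. restrict \<omega> K)"
    using indep_var_restrict[OF indep_vars_bond_space assms(3-5)] by simp
  from indep_varD[OF this assms(1,2)] show ?thesis
    by (simp add: emeasure_eq_measure ennreal_mult' vimage_def Int_def conj_commute)
qed

text \<open>Splitting off the last step gives a countable union over vertices. Keeping
  \<open>F\<close> apart from \<open>J\<close> makes the result usable both on the full space and on
  spaces of restricted configurations.\<close>

lemma pred_relpow_open:
  fixes F :: "'a set set"
  assumes "countable V" "simple_graph V F" "F \<subseteq> J" "u \<in> V"
  shows "Measurable.pred (bond_space J q) (\<lambda>\<omega>. (u, v) \<in> adj_rel (open_edges F \<omega>) ^^ n)"
proof (induction n arbitrary: v)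
  case (Suc n)
  have eq: "(u, v) \<in> adj_rel (open_edges F \<omega>) ^^ Suc n \<longleftrightarrow>
      (\<exists>w\<in>V. (u, w) \<in> adj_rel (open_edges F \<omega>) ^^ n \<and> {w, v} \<in> F \<and> \<omega> {w, v})" for \<omega>
  proof -
    have "w \<in> V" if "{w, v} \<in> F" for w
      using simple_graph_edge[OF assms(2) that] ..
    then show ?thesis
      by (auto simp: relcomp_unfold adj_rel_def open_edges_def)
  qed
  have [measurable]: "Measurable.pred (bond_space J q) (\<lambda>\<omega>. {w, v} \<in> F \<and> \<omega> {w, v})" for w
  proof (cases "{w, v} \<in> F")
    case True
    then have "(\<lambda>\<omega>. \<omega> {w, v}) \<in> measurable (bond_space J q) (measure_pmf q)"
      using assms(3) by (intro measurable_component_singleton) auto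
    then show ?thesis using True by (simp cong: measurable_cong_sets)
  qed simp
  note Suc[measurable]
  show ?case
    unfolding eq using assms(1) by measurable
qed simp

lemma pred_graph_dist_less:
  assumes "countable V" "simple_graph V F" "F \<subseteq> J" "u \<in> V"
  shows "Measurable.pred (bond_space J q) (\<lambda>\<omega>. graph_dist (open_edges F \<omega>) u v < enat n)"
  unfolding graph_dist_less_iff using pred_relpow_open[OF assms, measurable] by measurable

lemma pred_graph_dist_ge:
  assumes "countable V" "simple_graph V F" "F \<subseteq> J" "u \<in> V"
  shows "Measurable.pred (bond_space J q) (\<lambda>\<omega>. enat n \<le> graph_dist (open_edges F \<omega>) u v)"
  unfolding graph_dist_ge_iff using pred_relpow_open[OF assms, measurable] by measurable

lemma pred_graph_dist_eq:
  assumes "countable V" "simple_graph V F" "F \<subseteq> J" "u \<in> V"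
  shows "Measurable.pred (bond_space J q) (\<lambda>\<omega>. graph_dist (open_edges F \<omega>) u v = enat n)"
  unfolding graph_dist_eq_iff using pred_relpow_open[OF assms, measurable] by measurable

lemma pred_graph_dist_finite:
  assumes "countable V" "simple_graph V F" "F \<subseteq> J" "u \<in> V"
  shows "Measurable.pred (bond_space J q) (\<lambda>\<omega>. graph_dist (open_edges F \<omega>) u v < \<infinity>)"
  unfolding graph_dist_finite_iff rtrancl_power using pred_relpow_open[OF assms, measurable] by measurable

text \<open>The ball stays inside \<open>V\<close>, so the equality of sets amounts to countably
  many conditions, one per vertex.\<close>

lemma pred_ball_eq:
  assumes "countable V" "simple_graph V F" "F \<subseteq> J" "u \<in> V" "S \<subseteq> V"
  shows "Measurable.pred (bond_space J q) (\<lambda>\<omega>. {x. graph_dist (open_edges F \<omega>) u x < enat n} = S)"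
proof -
  have "(\<forall>x. graph_dist (open_edges F \<omega>) u x < enat n \<longrightarrow> x \<in> V)" for \<omega>
  proof safe
    fix x assume "graph_dist (open_edges F \<omega>) u x < enat n"
    moreover have "simple_graph V (open_edges F \<omega>)"
      using assms(2) by (auto simp: simple_graph_def open_edges_def)
    ultimately show "x \<in> V"
      using relpow_adj_rel_in assms(4) unfolding graph_dist_less_iff by metis
  qed
  then have eq: "{x. graph_dist (open_edges F \<omega>) u x < enat n} = S \<longleftrightarrow>
      (\<forall>x\<in>V. graph_dist (open_edges F \<omega>) u x < enat n \<longleftrightarrow> x \<in> S)" for \<omega>
    using assms(5) by blast
  note pred_graph_dist_less[OF assms(1-4), measurable]
  show ?thesis
    unfolding eq using assms(1) by measurable
qed

section \<open>Tail of the intrinsic distance\<close>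

locale bond_percolation =
  fixes V :: "'a set" and E :: "'a set set" and q :: "bool pmf"
  assumes simple: "simple_graph V E"
    and countable_V: "countable V"
    and locally_finite: "locally_finite_graph V E"
begin

abbreviation M :: "('a set \<Rightarrow> bool) measure" where
  "M \<equiv> bond_space E q"

sublocale prob_space M
  by (rule prob_space_bond_space)

sublocale edges: product_prob_space "\<lambda>_. measure_pmf q" E
  by unfold_locales

definition tail :: "'a set set \<Rightarrow> nat \<Rightarrow> 'a \<Rightarrow> 'a \<Rightarrow> ennreal" where
  "tail F n u v = emeasure M {\<omega> \<in> space M.
     enat n \<le> graph_dist (open_edges F \<omega>) u v \<and> graph_dist (open_edges F \<omega>) u v < \<infinity>}"

definition exact :: "'a set set \<Rightarrow> nat \<Rightarrow> 'a \<Rightarrow> 'a \<Rightarrow> ennreal" where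
  "exact F n u v = emeasure M {\<omega> \<in> space M. graph_dist (open_edges F \<omega>) u v = enat n}"

text \<open>At \<open>n = 0\<close> the lower bound on the distance is vacuous, so this is the
  probability of being connected. As a tail it serves as the base of the iteration.\<close>

definition two_pt :: "'a \<Rightarrow> 'a \<Rightarrow> ennreal" where
  "two_pt u v = tail E 0 u v"

lemma open_edges_subset: "open_edges F \<omega> \<subseteq> F"
  by (auto simp: open_edges_def)

lemma open_edges_mono: "F \<subseteq> F' \<Longrightarrow> open_edges F \<omega> \<subseteq> open_edges F' \<omega>"
  by (auto simp: open_edges_def)

lemma finite_ball:
  assumes "F \<subseteq> E" "u \<in> V"
  shows "{x. graph_dist F u x < enat n} \<subseteq> V" "finite {x. graph_dist F u x < enat n}"
proof -
  have sub: "{x. graph_dist F u x < enat n} \<subseteq> (\<Union>k<n. {x. (u, x) \<in> adj_rel E ^^ k})"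
    using relpow_adj_rel_mono[OF assms(1)] by (auto simp: graph_dist_less_iff)
  also have "\<dots> \<subseteq> V"
    using relpow_adj_rel_in[OF simple _ assms(2)] by auto
  finally show "{x. graph_dist F u x < enat n} \<subseteq> V" .
  show "finite {x. graph_dist F u x < enat n}"
    using finite_relpow_ball[OF simple locally_finite assms(2)]
    by (intro finite_subset[OF sub]) auto
qed

lemma sets_far:
  assumes "F \<subseteq> J" "F \<subseteq> E" "u \<in> V"
  shows "{\<omega> \<in> space (bond_space J q). enat n \<le> graph_dist (open_edges F \<omega>) u v \<and>
    graph_dist (open_edges F \<omega>) u v < \<infinity>} \<in> sets (bond_space J q)"
  using pred_graph_dist_ge[OF countable_V simple_graph_subset[OF simple assms(2)] assms(1,3), measurable]
    pred_graph_dist_finite[OF countable_V simple_graph_subset[OF simple assms(2)] assms(1,3), measurable]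
  by measurable

lemma sets_exact:
  assumes "F \<subseteq> J" "F \<subseteq> E" "u \<in> V"
  shows "{\<omega> \<in> space (bond_space J q). graph_dist (open_edges F \<omega>) u v = enat n} \<in> sets (bond_space J q)"
  using pred_graph_dist_eq[OF countable_V simple_graph_subset[OF simple assms(2)] assms(1,3), measurable]
  by measurable

lemma sets_exact_ball:
  assumes "F \<subseteq> J" "F \<subseteq> E" "u \<in> V" "S \<subseteq> V"
  shows "{\<omega> \<in> space (bond_space J q). graph_dist (open_edges F \<omega>) u v = enat n \<and>
    {x. graph_dist (open_edges F \<omega>) u x < enat n} = S} \<in> sets (bond_space J q)"
  using pred_graph_dist_eq[OF countable_V simple_graph_subset[OF simple assms(2)] assms(1,3), measurable]
    pred_ball_eq[OF countable_V simple_graph_subset[OF simple assms(2)] assms(1,3,4), measurable]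
  by measurable

lemma tail_antimono: "n \<le> n' \<Longrightarrow> F \<subseteq> E \<Longrightarrow> u \<in> V \<Longrightarrow> tail F n' u v \<le> tail F n u v"
  unfolding tail_def by (intro emeasure_mono sets_far) (auto intro: order_trans[of "enat n" "enat n'"])

text \<open>More edges mean shorter distances: connection survives the passage from \<open>F\<close>
  to \<open>E\<close>, but the lower bound \<open>n\<close> may not and is dropped. The result is
  uniform in \<open>F\<close>.\<close>

lemma tail_le_two_pt:
  assumes "F \<subseteq> E" "u \<in> V"
  shows "tail F n u v \<le> two_pt u v"
proof -
  have "enat 0 \<le> x" for x
    by (simp add: zero_enat_def[symmetric])
  moreover have "graph_dist (open_edges E \<omega>) u v \<le> graph_dist (open_edges F \<omega>) u v" for \<omega>
    using assms(1) by (intro graph_dist_antimono open_edges_mono)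
  ultimately show ?thesis
    unfolding two_pt_def tail_def using assms
    by (intro emeasure_mono sets_far) (blast intro: order.strict_trans1)+
qed

text \<open>The events for distinct \<open>j\<close> are disjoint and all imply connection. So
  \<open>m\<close> radii share the mass of one two-point function, the source of the factor
  \<open>1 / m\<close>.\<close>

lemma sum_exact_le:
  assumes "F \<subseteq> E" "u \<in> V"
  shows "(\<Sum>j<m. exact F j u w) \<le> two_pt u w"
proof -
  have "(\<Sum>j<m. exact F j u w) =
      emeasure M (\<Union>j<m. {\<omega> \<in> space M. graph_dist (open_edges F \<omega>) u w = enat j})"
    unfolding exact_def
  proof (rule sum_emeasure)
    show "(\<lambda>j. {\<omega> \<in> space M. graph_dist (open_edges F \<omega>) u w = enat j}) ` {..<m} \<subseteq> sets M"
      using sets_exact[OF assms(1) assms] by blast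
    show "disjoint_family_on (\<lambda>j. {\<omega> \<in> space M. graph_dist (open_edges F \<omega>) u w = enat j}) {..<m}"
      unfolding disjoint_family_on_def by force
  qed simp
  also have "\<dots> \<le> tail F 0 u w"
    unfolding tail_def using assms
    by (intro emeasure_mono sets_far) (auto simp: zero_enat_def[symmetric])
  also have "\<dots> \<le> two_pt u w"
    using assms by (rule tail_le_two_pt)
  finally show ?thesis .
qed

text \<open>The key inequality is obtained by conditioning on the ball \<open>S\<close> of radius \<open>j\<close> about \<open>u\<close>:
  beyond the sphere the path only uses edges that avoid \<open>S\<close>. Conditioning replaces \<open>F\<close> by a
  smaller edge set, and \<open>tail\<close> is not monotone in the edge set, which is why the hypothesis ranges
  over all \<open>F'\<close>.\<close>

lemma tail_add_le:
  assumes h: "\<And>F' w. F' \<subseteq> E \<Longrightarrow> w \<in> V \<Longrightarrow> tail F' i w v \<le> h w"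
    and F: "F \<subseteq> E" and u: "u \<in> V"
  shows "tail F (i + j) u v \<le> (\<integral>\<^sup>+w. exact F j u w * h w \<partial>count_space V)"
proof -
  \<comment> \<open>A countable set has countably many finite subsets, so one can sum over all
    possible balls.\<close>
  define Sf where "Sf = {S. finite S \<and> S \<subseteq> V}"
  have Sf: "countable Sf"
    unfolding Sf_def by (rule countable_Collect_finite_subset[OF countable_V])
  \<comment> \<open>\<open>D S w\<close> records that the ball is \<open>S\<close> and that
    \<open>w\<close> lies on its sphere; \<open>R S w\<close> is the event that the remaining path
    can be found among the edges avoiding \<open>S\<close>.\<close>
  define D where "D S w = {\<omega> \<in> space M. graph_dist (open_edges F \<omega>) u w = enat j \<and>
    {x. graph_dist (open_edges F \<omega>) u x < enat j} = S}" for S w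
  define R where "R S w = {\<omega> \<in> space M.
    enat i \<le> graph_dist (open_edges (F - touching F S) \<omega>) w v \<and>
    graph_dist (open_edges (F - touching F S) \<omega>) w v < \<infinity>}" for S w
  have D_sets[measurable]: "D S w \<in> sets M" if "S \<in> Sf" for S w
    unfolding D_def using that F u by (intro sets_exact_ball) (auto simp: Sf_def)
  have R_sets[measurable]: "R S w \<in> sets M" if "w \<in> V" for S w
    unfolding R_def using that F by (intro sets_far) auto
  have indep: "emeasure M (D S w \<inter> R S w) = emeasure M (D S w) * emeasure M (R S w)"
    if S: "S \<in> Sf" and w: "w \<in> V" for S w
  proof -
    define J where "J = touching F S"
    define K where "K = F - touching F S"
    have JK: "J \<inter> K = {}" "J \<subseteq> E" "K \<subseteq> E"
      using F by (auto simp: J_def K_def touching_def)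
    define A where "A = {\<omega> \<in> space (bond_space J q). graph_dist (open_edges J \<omega>) u w = enat j \<and>
      {x. graph_dist (open_edges J \<omega>) u x < enat j} = S}"
    define B where "B = {\<omega> \<in> space (bond_space K q). enat i \<le> graph_dist (open_edges K \<omega>) w v \<and>
      graph_dist (open_edges K \<omega>) w v < \<infinity>}"
    have A: "A \<in> sets (bond_space J q)"
      unfolding A_def using JK u S by (intro sets_exact_ball) (auto simp: Sf_def)
    have B: "B \<in> sets (bond_space K q)"
      unfolding B_def using JK w by (intro sets_far) auto
    have restr: "open_edges H (restrict \<omega> H) = open_edges H \<omega>" for H and \<omega> :: "'a set \<Rightarrow> bool"
      by (auto simp: open_edges_def)
    \<comment> \<open>The open edges in \<open>F\<close> and in \<open>J\<close> that touch
      \<open>S\<close> coincide, so locality of the ball, used in both directions, reads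
      \<open>D S w\<close> off from \<open>J\<close>.\<close>
    have "restrict \<omega> J \<in> A \<longleftrightarrow> \<omega> \<in> D S w" if "\<omega> \<in> space M" for \<omega>
    proof -
      have t: "touching (open_edges F \<omega>) S = touching (open_edges J \<omega>) S"
        by (auto simp: touching_def open_edges_def J_def)
      have "restrict \<omega> J \<in> space (bond_space J q)"
        by (auto simp: space_PiM)
      then show ?thesis
        using that ball_local[OF t, of u j] ball_local[OF t[symmetric], of u j]
        unfolding A_def D_def restr mem_Collect_eq by metis
    qed
    then have eA: "{\<omega> \<in> space M. restrict \<omega> J \<in> A} = D S w"
      by (auto simp: D_def)
    have "restrict \<omega> K \<in> B \<longleftrightarrow> \<omega> \<in> R S w" if "\<omega> \<in> space M" for \<omega>
    proof -
      have "restrict \<omega> K \<in> space (bond_space K q)"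
        by (auto simp: space_PiM)
      then show ?thesis
        using that unfolding B_def R_def restr mem_Collect_eq K_def[symmetric] by simp
    qed
    then have eB: "{\<omega> \<in> space M. restrict \<omega> K \<in> B} = R S w"
      by (auto simp: R_def)
    have "{\<omega> \<in> space M. restrict \<omega> J \<in> A \<and> restrict \<omega> K \<in> B} = D S w \<inter> R S w"
      using eA eB by blast
    with bond_space_indep[OF A B JK] show ?thesis
      by (simp add: eA eB)
  qed
  have "tail F (i + j) u v \<le> emeasure M (\<Union>w\<in>V. \<Union>S\<in>Sf. D S w \<inter> R S w)"
    unfolding tail_def
  proof (rule emeasure_mono)
    show "(\<Union>w\<in>V. \<Union>S\<in>Sf. D S w \<inter> R S w) \<in> sets M"
      by (intro sets.countable_UN' image_subsetI sets.Int D_sets R_sets countable_V Sf)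
    show "{\<omega> \<in> space M. enat (i + j) \<le> graph_dist (open_edges F \<omega>) u v \<and>
        graph_dist (open_edges F \<omega>) u v < \<infinity>} \<subseteq> (\<Union>w\<in>V. \<Union>S\<in>Sf. D S w \<inter> R S w)"
    proof safe
      fix \<omega> assume \<omega>: "\<omega> \<in> space M" "enat (i + j) \<le> graph_dist (open_edges F \<omega>) u v"
        "graph_dist (open_edges F \<omega>) u v < \<infinity>"
      define S where "S = {x. graph_dist (open_edges F \<omega>) u x < enat j}"
      from geodesic_split[OF \<omega>(2,3) S_def] obtain w where w:
        "graph_dist (open_edges F \<omega>) u w = enat j"
        "enat i \<le> graph_dist (open_edges F \<omega> - touching (open_edges F \<omega>) S) w v"
        "graph_dist (open_edges F \<omega> - touching (open_edges F \<omega>) S) w v < \<infinity>" .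
      have sub: "open_edges F \<omega> \<subseteq> E"
        using open_edges_subset F by blast
      have "S \<in> Sf"
        unfolding Sf_def S_def using finite_ball[OF sub u] by simp
      moreover have "w \<in> V"
        using finite_ball(1)[OF sub u, of "Suc j"] w(1) by auto
      moreover have "open_edges F \<omega> - touching (open_edges F \<omega>) S = open_edges (F - touching F S) \<omega>"
        by (auto simp: open_edges_def touching_def)
      with w \<omega> have "\<omega> \<in> R S w" "\<omega> \<in> D S w"
        by (auto simp: R_def D_def S_def)
      ultimately show "\<omega> \<in> (\<Union>w\<in>V. \<Union>S\<in>Sf. D S w \<inter> R S w)"
        by blast
    qed
  qed
  also have "\<dots> \<le> (\<integral>\<^sup>+w. emeasure M (\<Union>S\<in>Sf. D S w \<inter> R S w) \<partial>count_space V)"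
    by (intro emeasure_UN_countable_le sets.countable_UN' image_subsetI sets.Int D_sets R_sets countable_V Sf)
  also have "\<dots> \<le> (\<integral>\<^sup>+w. exact F j u w * h w \<partial>count_space V)"
  proof (intro nn_integral_mono, simp)
    fix w assume w: "w \<in> V"
    \<comment> \<open>The ball takes only one value, so for fixed \<open>w\<close> the probabilities
      of \<open>D S w\<close> add up to at most \<open>exact F j u w\<close>.\<close>
    have disj: "disjoint_family_on (\<lambda>S. D S w) Sf"
      by (auto simp: disjoint_family_on_def D_def)
    have "emeasure M (\<Union>S\<in>Sf. D S w \<inter> R S w) \<le> (\<integral>\<^sup>+S. emeasure M (D S w \<inter> R S w) \<partial>count_space Sf)"
      using Sf w by (intro emeasure_UN_countable_le) auto
    also have "\<dots> \<le> (\<integral>\<^sup>+S. emeasure M (D S w) * h w \<partial>count_space Sf)"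
    proof (intro nn_integral_mono, simp add: indep w)
      fix S assume "S \<in> Sf"
      \<comment> \<open>With \<open>S\<close> fixed, the remaining edges are a deterministic edge
        set to which the uniform hypothesis on \<open>h\<close> applies.\<close>
      have "emeasure M (R S w) = tail (F - touching F S) i w v"
        by (simp add: R_def tail_def)
      also have "\<dots> \<le> h w"
        using F w by (intro h) auto
      finally show "emeasure M (D S w) * emeasure M (R S w) \<le> emeasure M (D S w) * h w"
        by (rule mult_left_mono) simp
    qed
    also have "\<dots> = (\<integral>\<^sup>+S. emeasure M (D S w) \<partial>count_space Sf) * h w"
      by (rule nn_integral_multc) simp
    also have "(\<integral>\<^sup>+S. emeasure M (D S w) \<partial>count_space Sf) = emeasure M (\<Union>S\<in>Sf. D S w)"
      using Sf disj by (intro emeasure_UN_countable[symmetric]) auto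
    also have "\<dots> \<le> exact F j u w"
      unfolding exact_def using F u by (intro emeasure_mono sets_exact) (auto simp: D_def)
    finally show "emeasure M (\<Union>S\<in>Sf. D S w \<inter> R S w) \<le> exact F j u w * h w"
      by (simp add: mult_right_mono)
  qed
  finally show ?thesis .
qed

text \<open>This is \<open>T\<^sup>k\<^sup>+\<^sup>1 \<delta>\<^sub>v\<close> for the two-point kernel \<open>T\<close>; note the shift of the index.\<close>

primrec iter :: "'a \<Rightarrow> nat \<Rightarrow> 'a \<Rightarrow> ennreal" where
  "iter v 0 u = two_pt u v"
| "iter v (Suc k) u = (\<integral>\<^sup>+w. two_pt u w * iter v k w \<partial>count_space V)"

text \<open>Each block of \<open>m\<close> levels gains \<open>1 / m\<close> and applies the
  two-point kernel once. \<open>F\<close> and \<open>u\<close> are generalised in the induction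
  because the recursion changes both.\<close>

lemma tail_le_iter:
  assumes m: "0 < m" and "F \<subseteq> E" "u \<in> V"
  shows "tail F (k * m) u v \<le> ennreal (1 / m) ^ k * iter v k u"
  using assms(2,3)
proof (induction k arbitrary: F u)
  case 0
  then show ?case by (simp add: tail_le_two_pt)
next
  case (Suc k)
  define h where "h w = ennreal (1 / m) ^ k * iter v k w" for w
  \<comment> \<open>The recursion is summed over all crossing radii \<open>j < m\<close>, so that
    the disjointness of the spheres can be used.\<close>
  have "of_nat m * tail F (Suc k * m) u v = (\<Sum>j<m. tail F (Suc k * m) u v)"
    by simp
  also have "\<dots> \<le> (\<Sum>j<m. \<integral>\<^sup>+w. exact F j u w * h w \<partial>count_space V)"
  proof (rule sum_mono)
    fix j assume "j \<in> {..<m}"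
    \<comment> \<open>\<open>k * m + j \<le> Suc k * m\<close> because \<open>j < m\<close>.\<close>
    then have "tail F (Suc k * m) u v \<le> tail F (k * m + j) u v"
      using Suc.prems by (intro tail_antimono) auto
    also have "\<dots> \<le> (\<integral>\<^sup>+w. exact F j u w * h w \<partial>count_space V)"
      using Suc.IH Suc.prems by (intro tail_add_le) (auto simp: h_def)
    finally show "tail F (Suc k * m) u v \<le> (\<integral>\<^sup>+w. exact F j u w * h w \<partial>count_space V)" .
  qed
  also have "\<dots> = (\<integral>\<^sup>+w. (\<Sum>j<m. exact F j u w) * h w \<partial>count_space V)"
    by (simp add: nn_integral_sum sum_distrib_right)
  also have "\<dots> \<le> (\<integral>\<^sup>+w. two_pt u w * h w \<partial>count_space V)"
    using Suc.prems by (intro nn_integral_mono mult_right_mono sum_exact_le) auto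
  also have "\<dots> = (\<integral>\<^sup>+w. ennreal (1 / m) ^ k * (two_pt u w * iter v k w) \<partial>count_space V)"
    by (simp add: h_def ac_simps)
  also have "\<dots> = ennreal (1 / m) ^ k * iter v (Suc k) u"
    by (simp add: nn_integral_cmult)
  finally have le: "of_nat m * tail F (Suc k * m) u v \<le> ennreal (1 / m) ^ k * iter v (Suc k) u" .
  have one: "ennreal (1 / m) * of_nat m = 1"
    using m by (simp add: ennreal_of_nat_eq_real_of_nat ennreal_mult[symmetric])
  have "tail F (Suc k * m) u v = ennreal (1 / m) * of_nat m * tail F (Suc k * m) u v"
    by (simp only: one mult_1)
  also have "\<dots> = ennreal (1 / m) * (of_nat m * tail F (Suc k * m) u v)"
    by (simp only: mult.assoc)
  also have "\<dots> \<le> ennreal (1 / m) * (ennreal (1 / m) ^ k * iter v (Suc k) u)"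
    using le by (rule mult_left_mono) simp
  finally show ?case
    by (simp add: mult.assoc)
qed

end

section \<open>Operator norm on \<open>L\<^sup>2\<close> and monotonicity in \<open>p\<close>\<close>

lemma ennreal_power2_le_imp_le:
  fixes a b :: ennreal
  assumes "a\<^sup>2 \<le> b\<^sup>2" shows "a \<le> b"
proof (cases b)
  case (real s)
  have "a\<^sup>2 \<le> ennreal (s\<^sup>2)"
    using assms real by (simp add: ennreal_power)
  also have "\<dots> < \<infinity>"
    by simp
  finally obtain r where r: "0 \<le> r" "a = ennreal r"
    by (cases a) (auto simp: power2_eq_square)
  with real assms have "r\<^sup>2 \<le> s\<^sup>2"
    by (simp add: ennreal_power)
  with real r show ?thesis
    by (auto intro: power2_le_imp_le ennreal_leI)
qed simp

lemma ennreal_powr_2: "ennreal_powr x 2 = x\<^sup>2"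
proof (cases x)
  case top
  then show ?thesis by (simp add: ennreal_powr_def power2_eq_square)
qed (simp add: ennreal_powr_def ennreal_power)

lemma ennreal_powr_half: "(ennreal_powr x (1 / 2))\<^sup>2 = x"
  by (cases x) (auto simp: ennreal_powr_def ennreal_power powr_half_sqrt power2_eq_square ennreal_mult[symmetric])

lemma Lq_norm_2: "(Lq_norm 2 V f)\<^sup>2 = (\<integral>\<^sup>+v. (f v)\<^sup>2 \<partial>count_space V)"
  unfolding Lq_norm_def ennreal_powr_half ennreal_powr_2 ..

text \<open>The operator norm tests real functions of finite nonzero norm; norms 0 and \<infinity>
  are added here. Extended values are allowed so that the bound applies to iterates before these are
  known to be finite.\<close>

lemma L2_bound_of_op_norm:
  assumes "op_norm 2 V T < \<infinity>"
  obtains K :: real where "0 < K"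
    "\<And>f. (\<integral>\<^sup>+u. (\<integral>\<^sup>+w. T u w * f w \<partial>count_space V)\<^sup>2 \<partial>count_space V) \<le>
      (ennreal K)\<^sup>2 * (\<integral>\<^sup>+w. (f w)\<^sup>2 \<partial>count_space V)"
proof -
  \<comment> \<open>The added 1 makes \<open>K\<close> positive, so the right side is infinite
    whenever the norm of \<open>f\<close> is.\<close>
  define K where "K = enn2real (op_norm 2 V T) + 1"
  have "0 < K" by (simp add: K_def add_nonneg_pos)
  have op_le: "op_norm 2 V T \<le> ennreal K"
    using assms by (cases "op_norm 2 V T") (auto simp: K_def)
  have "(\<integral>\<^sup>+u. (\<integral>\<^sup>+w. T u w * f w \<partial>count_space V)\<^sup>2 \<partial>count_space V) \<le>
      (ennreal K)\<^sup>2 * (\<integral>\<^sup>+w. (f w)\<^sup>2 \<partial>count_space V)" for f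
  proof -
    define I where "I = (\<integral>\<^sup>+w. (f w)\<^sup>2 \<partial>count_space V)"
    consider "I = 0" | "I = \<infinity>" | "I \<noteq> 0" "I < \<infinity>"
      by (cases "I = 0"; cases "I = \<infinity>") (auto simp: less_top[symmetric])
    then show ?thesis
    proof cases
      case 1
      then have "\<forall>w\<in>V. f w = 0"
        unfolding I_def by (subst (asm) nn_integral_0_iff_AE) (auto simp: AE_count_space)
      then have "(\<integral>\<^sup>+w. T u w * f w \<partial>count_space V) = 0" for u
        by (subst nn_integral_0_iff_AE) (auto simp: AE_count_space)
      then show ?thesis by simp
    next
      case 2
      then show ?thesis
        unfolding I_def[symmetric] using \<open>0 < K\<close>
        by (simp add: ennreal_mult_top power2_eq_square ennreal_mult[symmetric])
    next
      case 3
      \<comment> \<open>A finite sum of squares forces \<open>f\<close> to be finite on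
        \<open>V\<close>, so \<open>f\<close> agrees there with a real test function.\<close>
      define g where "g w = enn2real (f w)" for w
      have fg: "f w = ennreal (g w)" if "w \<in> V" for w
      proof -
        have "(f w)\<^sup>2 \<le> I"
          unfolding I_def using that by (rule nn_integral_ge_point)
        then have "f w \<noteq> \<infinity>"
          using 3 by (auto simp: power2_eq_square top_unique)
        then show ?thesis
          by (cases "f w") (auto simp: g_def)
      qed
      let ?n = "Lq_norm 2 V (\<lambda>v. ennreal (g v))" and ?k = "Lq_norm 2 V (kernel_apply V T g)"
      have n: "?n\<^sup>2 = I"
        unfolding Lq_norm_2 I_def by (intro nn_integral_cong) (simp add: fg)
      have "?n < \<infinity>"
        using n 3 by (cases ?n) (auto simp: power2_eq_square)
      moreover have "?n \<noteq> 0"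
        using n 3 by (auto simp: less_top power2_eq_square)
      moreover have "\<exists>v\<in>V. g v \<noteq> 0"
      proof (rule ccontr)
        assume "\<not> (\<exists>v\<in>V. g v \<noteq> 0)"
        then have "I = 0"
          unfolding I_def by (subst nn_integral_0_iff_AE) (auto simp: AE_count_space fg)
        with 3 show False by simp
      qed
      ultimately have "?k / ?n \<le> op_norm 2 V T"
        unfolding op_norm_def by (intro SUP_upper) (auto simp: g_def)
      with op_le have "?k / ?n \<le> ennreal K" by order
      \<comment> \<open>Multiplication undoes the quotient, as \<open>?n\<close> is neither zero nor
        infinite.\<close>
      then have "?k / ?n * ?n \<le> ennreal K * ?n"
        by (rule mult_right_mono) simp
      then have "?k \<le> ennreal K * ?n"
        using \<open>?n < \<infinity>\<close> \<open>?n \<noteq> 0\<close> by (simp add: ennreal_divide_times ennreal_times_divide mult_divide_eq_ennreal)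
      then have "?k\<^sup>2 \<le> (ennreal K)\<^sup>2 * I"
        unfolding n[symmetric] power_mult_distrib[symmetric] by (rule power_mono) simp
      also have "?k\<^sup>2 = (\<integral>\<^sup>+u. (\<integral>\<^sup>+w. T u w * f w \<partial>count_space V)\<^sup>2 \<partial>count_space V)"
        unfolding Lq_norm_2 kernel_apply_def
        by (intro nn_integral_cong arg_cong[where f="\<lambda>x. x\<^sup>2"]) (simp add: fg)
      finally show ?thesis unfolding I_def .
    qed
  qed
  with that \<open>0 < K\<close> show thesis by blast
qed

lemma op_norm_mono:
  assumes "\<And>u v. u \<in> V \<Longrightarrow> v \<in> V \<Longrightarrow> T u v \<le> T' u v"
    and "q > 0"
  shows "op_norm q V T \<le> op_norm q V T'"
proof -
  have powr: "ennreal_powr x a \<le> ennreal_powr y a" if "x \<le> y" "a > 0" for x y a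
    using that by (cases x; cases y) (auto simp: ennreal_powr_def top_unique intro!: powr_mono2)
  show ?thesis
    unfolding op_norm_def Lq_norm_def kernel_apply_def using assms
    by (intro SUP_mono' divide_right_mono_ennreal powr nn_integral_mono mult_right_mono) auto
qed

text \<open>A kernel below the identity is a contraction. At \<open>p = 0\<close> this shows that
  the set defining \<open>p_2_2\<close> is nonempty.\<close>

lemma op_norm_diagonal_le:
  assumes "\<And>u v. u \<in> V \<Longrightarrow> v \<in> V \<Longrightarrow> T u v \<le> indicator {u} v"
  shows "op_norm 2 V T \<le> 1"
  unfolding op_norm_def
proof (rule SUP_least, safe)
  fix f :: "'a \<Rightarrow> real"
  let ?n = "Lq_norm 2 V (\<lambda>v. ennreal (f v))"
  assume fin: "?n < \<infinity>"
  have "(Lq_norm 2 V (kernel_apply V T f))\<^sup>2 \<le> ?n\<^sup>2"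
    unfolding Lq_norm_2
  proof (intro nn_integral_mono power_mono; simp?)
    fix u assume u: "u \<in> V"
    have "kernel_apply V T f u \<le> (\<integral>\<^sup>+v. ennreal (f v) * indicator {u} v \<partial>count_space V)"
      unfolding kernel_apply_def using assms[OF u]
      by (intro nn_integral_mono) (auto simp: mult.commute intro: mult_left_mono)
    also have "\<dots> = ennreal (f u)"
      using u by (subst nn_integral_indicator_singleton) auto
    finally show "kernel_apply V T f u \<le> ennreal (f u)" .
  qed
  then have le: "Lq_norm 2 V (kernel_apply V T f) \<le> ?n"
    by (rule ennreal_power2_le_imp_le)
  show "Lq_norm 2 V (kernel_apply V T f) / ?n \<le> 1"
  proof (cases "?n = 0")
    case True
    \<comment> \<open>The numerator vanishes too, and 0 / 0 is 0 in \<open>ennreal\<close>.\<close>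
    with le show ?thesis by simp
  next
    case False
    have "Lq_norm 2 V (kernel_apply V T f) / ?n \<le> ?n / ?n"
      using le by (rule divide_right_mono_ennreal)
    also have "\<dots> = 1"
      using False fin by (simp add: ennreal_divide_self)
    finally show ?thesis .
  qed
qed

section \<open>Monotone coupling in \<open>p\<close>\<close>

lemma emeasure_bond_space_map:
  assumes "A \<in> sets (bond_space J (map_pmf f q))"
  shows "emeasure (bond_space J (map_pmf f q)) A =
    emeasure (bond_space J q) {\<omega> \<in> space (bond_space J q). (\<lambda>e\<in>J. f (\<omega> e)) \<in> A}"
    and "{\<omega> \<in> space (bond_space J q). (\<lambda>e\<in>J. f (\<omega> e)) \<in> A} \<in> sets (bond_space J q)"
proof -
  have f: "f \<in> measurable (measure_pmf q) (measure_pmf (map_pmf f q))"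
    by simp
  have meas: "(\<lambda>\<omega>. \<lambda>e\<in>J. f (\<omega> e)) \<in> measurable (bond_space J q) (bond_space J (map_pmf f q))"
    by (intro measurable_restrict measurable_compose[OF _ f] measurable_component_singleton)
  have eq: "(\<lambda>\<omega>. \<lambda>e\<in>J. f (\<omega> e)) -` A \<inter> space (bond_space J q) =
      {\<omega> \<in> space (bond_space J q). (\<lambda>e\<in>J. f (\<omega> e)) \<in> A}"
    by auto
  show "emeasure (bond_space J (map_pmf f q)) A =
      emeasure (bond_space J q) {\<omega> \<in> space (bond_space J q). (\<lambda>e\<in>J. f (\<omega> e)) \<in> A}"
    using emeasure_distr[OF meas assms] by (simp add: eq distr_bond_space)
  show "{\<omega> \<in> space (bond_space J q). (\<lambda>e\<in>J. f (\<omega> e)) \<in> A} \<in> sets (bond_space J q)"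
    using measurable_sets[OF meas assms] by (simp add: eq)
qed

text \<open>Thinning: \<open>p' * (p / p') = p\<close>. It realises the sparser percolation inside
  the denser one.\<close>

lemma bernoulli_pmf_thinning:
  assumes "0 \<le> p" "p \<le> p'" "p' \<le> 1" "0 < p'"
  shows "map_pmf (\<lambda>(a, b). a \<and> b) (pair_pmf (bernoulli_pmf p') (bernoulli_pmf (p / p'))) = bernoulli_pmf p"
    (is "map_pmf ?f ?Q = _")
proof (rule pmf_eqI)
  fix b :: bool
  have T: "?f -` {True} = {(True, True)}" and F: "?f -` {False} = {(True, False), (False, True), (False, False)}"
    by auto
  have r: "0 \<le> p / p'" "p / p' \<le> 1"
    using assms by auto
  show "pmf (map_pmf ?f ?Q) b = pmf (bernoulli_pmf p) b"
  proof (cases b)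
    case True
    then show ?thesis
      using assms r by (simp only: pmf_map T) (simp add: measure_pmf_single pmf_pair)
  next
    case False
    then show ?thesis
      using assms r by (simp only: pmf_map F)
        (simp add: measure_measure_pmf_finite pmf_pair field_simps)
  qed
qed

lemma two_point_eq:
  assumes "v \<in> V"
  shows "two_point V E p u v = emeasure (bond_space E (bernoulli_pmf p))
    {\<omega> \<in> space (bond_space E (bernoulli_pmf p)). graph_dist (open_edges E \<omega>) u v < \<infinity>}"
proof -
  interpret prob_space "bond_space E (bernoulli_pmf p)" by (rule prob_space_bond_space)
  show ?thesis
    unfolding two_point_def percolation_def cluster_def graph_dist_finite_iff
    using assms by (simp add: emeasure_eq_measure)
qed

text \<open>Both percolations live on one space with two bits per edge: the conjunction gives
  parameter \<open>p\<close>, the first bit gives \<open>p'\<close>. Every edge open in the former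
  is open in the latter.\<close>

lemma two_point_mono:
  assumes "countable V" "simple_graph V E" "u \<in> V" "v \<in> V"
    and p: "0 \<le> p" "p \<le> p'" "p' \<le> 1" "0 < p'"
  shows "two_point V E p u v \<le> two_point V E p' u v"
proof -
  let ?Q = "pair_pmf (bernoulli_pmf p') (bernoulli_pmf (p / p'))"
  let ?f = "\<lambda>(a, b). a \<and> b"
  let ?A = "\<lambda>q. {\<omega> \<in> space (bond_space E q). graph_dist (open_edges E \<omega>) u v < \<infinity>}"
  have A: "?A q \<in> sets (bond_space E q)" for q
    using pred_graph_dist_finite[OF assms(1,2) order_refl assms(3), measurable] by measurable
  have eq: "two_point V E r u v =
      emeasure (bond_space E ?Q) {\<omega> \<in> space (bond_space E ?Q). (\<lambda>e\<in>E. f (\<omega> e)) \<in> ?A (map_pmf f ?Q)}"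
    if "map_pmf f ?Q = bernoulli_pmf r" for f r
  proof -
    have "two_point V E r u v = emeasure (bond_space E (map_pmf f ?Q)) (?A (map_pmf f ?Q))"
      unfolding that by (rule two_point_eq[OF assms(4)])
    also note emeasure_bond_space_map(1)[OF A]
    finally show ?thesis .
  qed
  have "two_point V E p u v =
      emeasure (bond_space E ?Q) {\<omega> \<in> space (bond_space E ?Q). (\<lambda>e\<in>E. ?f (\<omega> e)) \<in> ?A (map_pmf ?f ?Q)}"
    by (rule eq[OF bernoulli_pmf_thinning[OF p]])
  also have "\<dots> \<le> emeasure (bond_space E ?Q)
      {\<omega> \<in> space (bond_space E ?Q). (\<lambda>e\<in>E. fst (\<omega> e)) \<in> ?A (map_pmf fst ?Q)}"
  proof (rule emeasure_mono[OF _ emeasure_bond_space_map(2)[OF A]])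
    have le: "graph_dist (open_edges E (\<lambda>e\<in>E. fst (\<omega> e))) u v \<le>
        graph_dist (open_edges E (\<lambda>e\<in>E. ?f (\<omega> e))) u v" for \<omega> :: "'a set \<Rightarrow> bool \<times> bool"
      by (intro graph_dist_antimono) (auto simp: open_edges_def)
    show "{\<omega> \<in> space (bond_space E ?Q). (\<lambda>e\<in>E. ?f (\<omega> e)) \<in> ?A (map_pmf ?f ?Q)} \<subseteq>
        {\<omega> \<in> space (bond_space E ?Q). (\<lambda>e\<in>E. fst (\<omega> e)) \<in> ?A (map_pmf fst ?Q)}"
    proof
      fix \<omega> assume "\<omega> \<in> {\<omega> \<in> space (bond_space E ?Q). (\<lambda>e\<in>E. ?f (\<omega> e)) \<in> ?A (map_pmf ?f ?Q)}"
      then have "\<omega> \<in> space (bond_space E ?Q)"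
        and "graph_dist (open_edges E (\<lambda>e\<in>E. ?f (\<omega> e))) u v < \<infinity>"
        by blast+
      moreover have "(\<lambda>e\<in>E. fst (\<omega> e)) \<in> space (bond_space E (map_pmf fst ?Q))"
        by (simp add: space_PiM)
      ultimately show "\<omega> \<in> {\<omega> \<in> space (bond_space E ?Q). (\<lambda>e\<in>E. fst (\<omega> e)) \<in> ?A (map_pmf fst ?Q)}"
        using le[of \<omega>] unfolding mem_Collect_eq by (blast intro: order.strict_trans1)
    qed
  qed
  also have "\<dots> = two_point V E p' u v"
    by (rule eq[symmetric]) (rule map_fst_pair_pmf)
  finally show ?thesis .
qed

text \<open>At parameter 0, almost surely none of the finitely many edges at \<open>u\<close> is
  open, so no open walk leaves \<open>u\<close>.\<close>

lemma two_point_0_le: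
  assumes "locally_finite_graph V E" "u \<in> V" "v \<in> V"
  shows "two_point V E 0 u v \<le> indicator {u} v"
proof (cases "u = v")
  case True
  interpret prob_space "bond_space E (bernoulli_pmf 0)" by (rule prob_space_bond_space)
  show ?thesis
    using True by (simp add: two_point_eq[OF assms(3)] emeasure_le_1)
next
  case False
  have "AE \<omega> in bond_space E (bernoulli_pmf 0). \<forall>e\<in>{e \<in> E. u \<in> e}. \<not> \<omega> e"
  proof (rule AE_finite_allI)
    show "finite {e \<in> E. u \<in> e}"
      using assms by (simp add: locally_finite_graph_def)
    have "AE x in measure_pmf (bernoulli_pmf 0). \<not> x"
      by (auto simp: AE_measure_pmf_iff set_pmf_iff)
    then show "AE \<omega> in bond_space E (bernoulli_pmf 0). \<not> \<omega> e" if "e \<in> {e \<in> E. u \<in> e}" for e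
      using that by (intro AE_PiM_component measure_pmf.prob_space_axioms) auto
  qed
  then have "AE \<omega> in bond_space E (bernoulli_pmf 0). \<not> graph_dist (open_edges E \<omega>) u v < \<infinity>"
  proof eventually_elim
    case (elim \<omega>)
    show ?case
    proof
      assume "graph_dist (open_edges E \<omega>) u v < \<infinity>"
      then obtain w where "{u, w} \<in> open_edges E \<omega>"
        unfolding graph_dist_finite_iff using False by (auto elim: converse_rtranclE simp: adj_rel_def)
      with elim show False by (auto simp: open_edges_def)
    qed
  qed
  then have "two_point V E 0 u v = 0"
    unfolding two_point_eq[OF assms(3)] by (rule emeasure_eq_0_AE)
  then show ?thesis by simp
qed

text \<open>The supremum is over a nonempty bounded set, so some \<open>p' > p\<close> in it has
  finite norm, and monotonicity brings finiteness down to \<open>p\<close>.\<close>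

lemma below_p_2_2:
  assumes "countable V" "simple_graph V E" "locally_finite_graph V E"
    and "0 < p" "p < p_2_2 V E"
  shows "p < 1" "op_norm 2 V (two_point V E p) < \<infinity>"
proof -
  let ?S = "{p. 0 \<le> p \<and> p \<le> 1 \<and> op_norm 2 V (two_point V E p) < \<infinity>}"
  have "op_norm 2 V (two_point V E 0) \<le> 1"
    using two_point_0_le[OF assms(3)] by (rule op_norm_diagonal_le)
  also have "1 < (\<infinity> :: ennreal)"
    by simp
  finally have "0 \<in> ?S"
    by simp
  then have "?S \<noteq> {}"
    by blast
  moreover have "bdd_above ?S"
    by (rule bdd_aboveI[of _ 1]) simp
  ultimately have "\<exists>p'\<in>?S. p < p'"
    using less_cSup_iff[of ?S p] assms(5)[unfolded p_2_2_def] by blast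
  then obtain p' where p': "p' \<le> 1" "op_norm 2 V (two_point V E p') < \<infinity>" "p < p'"
    by auto
  then show "p < 1" by simp
  have "op_norm 2 V (two_point V E p) \<le> op_norm 2 V (two_point V E p')"
    using assms p' by (intro op_norm_mono two_point_mono) simp_all
  with p' show "op_norm 2 V (two_point V E p) < \<infinity>"
    by (auto intro: order.strict_trans1)
qed

section \<open>Exponential bounds\<close>

context bond_percolation
begin

text \<open>It suffices that all edges of one walk are open; these are at most \<open>n\<close>
  independent edges.\<close>

lemma two_pt_ge:
  assumes "(u, v) \<in> adj_rel E ^^ n" "u \<in> V"
  shows "ennreal (pmf q True ^ n) \<le> two_pt u v"
proof -
  obtain J where J: "J \<subseteq> E" "finite J" "card J \<le> n" "(u, v) \<in> adj_rel J ^^ n"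
    using walk_edges[OF assms(1)] .
  have "pmf q True ^ n \<le> pmf q True ^ card J"
    using J(3) by (intro power_decreasing) (auto simp: pmf_le_1)
  then have "ennreal (pmf q True ^ n) \<le> (\<Prod>e\<in>J. emeasure (measure_pmf q) {True})"
    by (simp add: emeasure_pmf_single ennreal_power)
  also have "\<dots> = emeasure M {\<omega> \<in> space M. \<forall>e\<in>J. \<omega> e \<in> {True}}"
    using J by (intro edges.emeasure_PiM_Collect[symmetric]) auto
  also have "\<dots> \<le> two_pt u v"
    unfolding two_pt_def tail_def
  proof (intro emeasure_mono sets_far; safe?)
    fix \<omega> assume "\<forall>e\<in>J. \<omega> e \<in> {True}"
    then have "J \<subseteq> open_edges E \<omega>"
      using J(1) by (auto simp: open_edges_def)
    then have "(u, v) \<in> adj_rel (open_edges E \<omega>) ^^ n"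
      using J(4) relpow_adj_rel_mono by metis
    then show "graph_dist (open_edges E \<omega>) u v < \<infinity>"
      unfolding graph_dist_finite_iff rtrancl_power by blast
    show "enat 0 \<le> graph_dist (open_edges E \<omega>) u v"
      by (simp add: zero_enat_def[symmetric])
  qed (use assms in auto)
  finally show ?thesis .
qed

end

locale L2_bounded_percolation = bond_percolation +
  fixes K :: real
  assumes K_pos: "0 < K"
    and L2_bound: "(\<integral>\<^sup>+u. (\<integral>\<^sup>+w. two_pt u w * f w \<partial>count_space V)\<^sup>2 \<partial>count_space V) \<le>
      (ennreal K)\<^sup>2 * (\<integral>\<^sup>+w. (f w)\<^sup>2 \<partial>count_space V)"
begin

text \<open>The indicator of \<open>v\<close> has norm 1, and each of the \<open>Suc k\<close>
  applications of the kernel costs at most a factor \<open>K\<close>.\<close>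

lemma L2_iter_le:
  assumes "v \<in> V"
  shows "(\<integral>\<^sup>+u. (iter v k u)\<^sup>2 \<partial>count_space V) \<le> (ennreal K ^ Suc k)\<^sup>2"
proof (induction k)
  case 0
  have "two_pt u v = (\<integral>\<^sup>+w. two_pt u w * indicator {v} w \<partial>count_space V)" for u
    using assms by (subst nn_integral_indicator_singleton) auto
  then have "(\<integral>\<^sup>+u. (iter v 0 u)\<^sup>2 \<partial>count_space V) \<le>
      (ennreal K)\<^sup>2 * (\<integral>\<^sup>+w. (indicator {v} w)\<^sup>2 \<partial>count_space V)"
    using L2_bound[of "indicator {v}"] by simp
  also have "(\<integral>\<^sup>+w. (indicator {v} w)\<^sup>2 \<partial>count_space V) = (\<integral>\<^sup>+w. 1 * indicator {v} w \<partial>count_space V)"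
    by (intro nn_integral_cong) (auto simp: indicator_def)
  also have "\<dots> = 1"
    using assms by (subst nn_integral_indicator_singleton) auto
  finally show ?case by simp
next
  case (Suc k)
  have "(\<integral>\<^sup>+u. (iter v (Suc k) u)\<^sup>2 \<partial>count_space V) \<le>
      (ennreal K)\<^sup>2 * (\<integral>\<^sup>+w. (iter v k w)\<^sup>2 \<partial>count_space V)"
    using L2_bound[of "iter v k"] by simp
  also have "\<dots> \<le> (ennreal K)\<^sup>2 * (ennreal K ^ Suc k)\<^sup>2"
    using Suc by (rule mult_left_mono) simp
  finally show ?case
    by (simp add: power_mult_distrib)
qed

text \<open>A single entry is at most the L2 norm of its column.\<close>

lemma iter_le:
  assumes "u \<in> V" "v \<in> V"
  shows "iter v k u \<le> ennreal K ^ Suc k"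
proof (rule ennreal_power2_le_imp_le)
  have "(iter v k u)\<^sup>2 \<le> (\<integral>\<^sup>+u. (iter v k u)\<^sup>2 \<partial>count_space V)"
    using assms(1) by (rule nn_integral_ge_point)
  also note L2_iter_le[OF assms(2)]
  finally show "(iter v k u)\<^sup>2 \<le> (ennreal K ^ Suc k)\<^sup>2" .
qed

lemma tail_exponential:
  obtains c C where "0 < c" "0 < C"
    "\<And>u v n. u \<in> V \<Longrightarrow> v \<in> V \<Longrightarrow> tail E n u v \<le> ennreal (C * exp (- c * real n))"
proof -
  \<comment> \<open>This makes \<open>K / m \<le> exp (- 1)\<close>: every block of \<open>m\<close>
    levels gains a factor e.\<close>
  define m where "m = nat \<lceil>K * exp 1\<rceil>"
  have m: "K * exp 1 \<le> real m" "0 < m"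
    using K_pos by (auto simp: m_def)
  have theta: "K / m \<le> exp (- 1)"
    using m by (simp add: exp_minus field_simps)
  have "tail E n u v \<le> ennreal (K * exp 1 * exp (- (1 / m) * real n))" if "u \<in> V" "v \<in> V" for u v n
  proof -
    \<comment> \<open>Rounding down to whole blocks loses less than one block, which accounts for
      \<open>exp 1\<close> in the constant.\<close>
    define k where "k = n div m"
    have "k * m \<le> n" "n < (k + 1) * m"
      using m by (auto simp: k_def algebra_simps intro: dividend_less_times_div)
    then have "real n < real ((k + 1) * m)"
      by (simp only: of_nat_less_iff)
    then have "real n < (real k + 1) * real m"
      by (simp add: algebra_simps)
    then have k: "real n / m - 1 \<le> real k"
      using m by (simp add: field_simps)
    have "tail E n u v \<le> tail E (k * m) u v"
      using \<open>k * m \<le> n\<close> that by (intro tail_antimono) auto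
    also have "\<dots> \<le> ennreal (1 / m) ^ k * iter v k u"
      using m that by (intro tail_le_iter) auto
    also have "\<dots> \<le> ennreal (1 / m) ^ k * ennreal K ^ Suc k"
      using iter_le[OF that] by (rule mult_left_mono) simp
    also have "\<dots> = ennreal ((1 / m) ^ k * K ^ Suc k)"
      using K_pos by (simp add: ennreal_power ennreal_mult)
    also have "(1 / m) ^ k * K ^ Suc k = K * (K / m) ^ k"
      by (simp add: power_divide)
    also have "\<dots> \<le> K * exp (- 1) ^ k"
      using theta K_pos by (intro mult_left_mono power_mono) auto
    also have "\<dots> = K * exp (- real k)"
      by (simp add: exp_of_nat_mult[symmetric])
    also have "\<dots> \<le> K * exp (1 - real n / m)"
      using k K_pos by simp
    also have "\<dots> = K * exp 1 * exp (- (1 / m) * real n)"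
      by (simp add: exp_diff exp_minus field_simps)
    finally show ?thesis
      by (simp add: ennreal_leI)
  qed
  with that[of "1 / m" "K * exp 1"] K_pos m show thesis by simp
qed

end

section \<open>From the exponential tail to the two estimates\<close>

context L2_bounded_percolation
begin

lemma cluster_eq:
  "cluster V E \<omega> u = {v \<in> V. graph_dist (open_edges E \<omega>) u v < \<infinity>}"
  unfolding cluster_def graph_dist_finite_iff ..

text \<open>In the union bound, \<open>exp (- c * lam * d v / 2)\<close> splits into two equal
  factors. One gives the decay in \<open>lam\<close>, since \<open>d v \<ge> 1\<close>; the other is
  at most \<open>a ^ (2 * d v)\<close> for large \<open>lam\<close>, and these terms sum to at most
  \<open>K\<^sup>2\<close>.\<close>

lemma ratio_tail:
  assumes conn: "\<And>v. v \<in> V \<Longrightarrow> graph_dist E u v < \<infinity>"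
    and q: "0 < pmf q True" and u: "u \<in> V"
    and C: "0 < c" "0 < C"
      "\<And>v n. v \<in> V \<Longrightarrow> tail E n u v \<le> ennreal (C * exp (- c * real n))"
    and lam: "1 \<le> lam" "8 * ln (1 / pmf q True) / c \<le> lam"
  shows "\<P>(\<omega> in M. ennreal lam \<le> (SUP v \<in> cluster V E \<omega> u - {u}.
      ennreal_of_enat (int_dist E \<omega> u v) / ennreal_of_enat (graph_dist E u v))) \<le>
    C * K\<^sup>2 * exp (- (c / 4) * lam)"
    (is "measure _ ?B \<le> _")
proof -
  define a where "a = pmf q True"
  have a: "0 < a" "a \<le> 1"
    using q by (auto simp: a_def pmf_le_1)
  define d where "d v = the_enat (graph_dist E u v)" for v
  have d: "graph_dist E u v = enat (d v)" if "v \<in> V" for v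
    using conn[OF that] by (cases "graph_dist E u v") (auto simp: d_def)
  have d_pos: "1 \<le> d v" if "v \<in> V - {u}" for v
  proof -
    have "d v \<noteq> 0"
    proof
      assume "d v = 0"
      with d[of v] that have "(u, v) \<in> adj_rel E ^^ 0"
        by (intro graph_dist_relpow) auto
      with that show False by auto
    qed
    then show ?thesis by simp
  qed
  define N where "N v = nat \<lceil>lam * d v / 2\<rceil>" for v
  define X where "X v = {\<omega> \<in> space M. enat (N v) \<le> graph_dist (open_edges E \<omega>) u v \<and>
    graph_dist (open_edges E \<omega>) u v < \<infinity>}" for v
  have X: "X v \<in> sets M" for v
    unfolding X_def using u by (intro sets_far) auto
  have "?B \<subseteq> (\<Union>v\<in>V - {u}. X v)"
  proof
    fix \<omega> assume "\<omega> \<in> ?B"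
    then have \<omega>: "\<omega> \<in> space M" "ennreal lam \<le> (SUP v \<in> cluster V E \<omega> u - {u}.
        ennreal_of_enat (int_dist E \<omega> u v) / ennreal_of_enat (graph_dist E u v))"
      by auto
    \<comment> \<open>The supremum need not be attained, so the level is halved to find a
      \<open>v\<close> exceeding it. An empty supremum is 0 and stays below
      \<open>lam\<close>.\<close>
    have "ennreal (lam / 2) < ennreal lam"
      using lam by (simp add: ennreal_less_iff)
    from order.strict_trans2[OF this \<omega>(2)] obtain v where v: "v \<in> cluster V E \<omega> u - {u}"
      "ennreal (lam / 2) < ennreal_of_enat (int_dist E \<omega> u v) / ennreal_of_enat (graph_dist E u v)"
      unfolding less_SUP_iff by blast
    from v(1) have vV: "v \<in> V - {u}" and fin: "graph_dist (open_edges E \<omega>) u v < \<infinity>"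
      by (auto simp: cluster_eq)
    from fin obtain k where k: "graph_dist (open_edges E \<omega>) u v = enat k"
      by (cases "graph_dist (open_edges E \<omega>) u v") auto
    have "ennreal (lam / 2) < ennreal (real k / real (d v))"
      using v(2) d[of v] vV d_pos[OF vV]
      by (simp add: int_dist_def k ennreal_of_nat_eq_real_of_nat divide_ennreal)
    then have "lam / 2 < real k / real (d v)"
      using lam by (simp add: ennreal_less_iff)
    then have "lam * d v / 2 < real k"
      using d_pos[OF vV] by (simp add: field_simps)
    then have "N v \<le> k"
      unfolding N_def by (simp add: ceiling_le_iff)
    then have "\<omega> \<in> X v"
      using \<omega>(1) by (simp add: X_def k)
    then show "\<omega> \<in> (\<Union>v\<in>V - {u}. X v)"
      using vV by blast
  qed
  then have "emeasure M ?B \<le> emeasure M (\<Union>v\<in>V - {u}. X v)"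
    using countable_V X by (intro emeasure_mono sets.countable_UN' image_subsetI countable_Diff)
  also have "\<dots> \<le> (\<integral>\<^sup>+v. emeasure M (X v) \<partial>count_space (V - {u}))"
    using countable_V X by (intro emeasure_UN_countable_le countable_Diff)
  also have "\<dots> \<le> (\<integral>\<^sup>+v. ennreal (C * exp (- (c / 4) * lam)) * (two_pt v u)\<^sup>2 \<partial>count_space (V - {u}))"
  proof (intro nn_integral_mono, simp only: space_count_space)
    fix v assume v: "v \<in> V - {u}"
    \<comment> \<open>The walk is reversed because the L2 bound controls the column
      \<open>two_pt v u\<close> as \<open>v\<close> varies.\<close>
    have "(v, u) \<in> adj_rel E ^^ d v"
      using graph_dist_relpow[OF d] v by (subst relpow_adj_rel_sym) simp
    then have a_le: "ennreal (a ^ d v) \<le> two_pt v u"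
      using v two_pt_ge by (simp add: a_def)
    \<comment> \<open>The threshold \<open>8 * ln (1 / a) / c\<close> is chosen for this
      inequality.\<close>
    have "- (c / 4) * lam \<le> 2 * ln a"
      using lam(2) C(1) a by (simp add: a_def[symmetric] ln_div field_simps)
    then have "- (c / 4) * lam * d v \<le> 2 * ln a * d v"
      by (rule mult_right_mono) simp
    then have "exp (- (c / 4) * lam * d v) \<le> exp (2 * ln a * d v)"
      by simp
    also have "\<dots> = (exp (d v * ln a))\<^sup>2"
      by (simp add: exp_double[symmetric] ac_simps)
    also have "exp (d v * ln a) = a ^ d v"
      using a by (simp add: exp_of_nat_mult)
    finally have e1: "exp (- (c / 4) * lam * d v) \<le> (a ^ d v)\<^sup>2" .
    have e2: "exp (- (c / 4) * lam * d v) \<le> exp (- (c / 4) * lam)"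
      using C(1) lam(1) d_pos[OF v] by simp
    have "lam * d v / 2 \<le> N v"
      unfolding N_def by linarith
    then have "exp (- c * N v) \<le> exp (- c * (lam * d v / 2))"
      using C(1) by simp
    also have "\<dots> = exp (- (c / 4) * lam * d v) * exp (- (c / 4) * lam * d v)"
      by (simp add: exp_add[symmetric] field_simps)
    also have "\<dots> \<le> exp (- (c / 4) * lam) * (a ^ d v)\<^sup>2"
      using e1 e2 by (intro mult_mono) auto
    finally have e3: "exp (- c * N v) \<le> exp (- (c / 4) * lam) * (a ^ d v)\<^sup>2" .
    have "emeasure M (X v) = tail E (N v) u v"
      by (simp add: X_def tail_def)
    also have "\<dots> \<le> ennreal (C * exp (- c * N v))"
      using v by (intro C) auto
    also have "\<dots> \<le> ennreal (C * (exp (- (c / 4) * lam) * (a ^ d v)\<^sup>2))"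
      using e3 C(2) by (intro ennreal_leI mult_left_mono) auto
    also have "\<dots> = ennreal (C * exp (- (c / 4) * lam)) * (ennreal (a ^ d v))\<^sup>2"
      using C(2) a by (simp add: ennreal_power ennreal_mult[symmetric] mult.assoc)
    also have "\<dots> \<le> ennreal (C * exp (- (c / 4) * lam)) * (two_pt v u)\<^sup>2"
      using a_le by (intro mult_left_mono power_mono) auto
    finally show "emeasure M (X v) \<le> ennreal (C * exp (- (c / 4) * lam)) * (two_pt v u)\<^sup>2" .
  qed
  also have "\<dots> \<le> (\<integral>\<^sup>+v. ennreal (C * exp (- (c / 4) * lam)) * (two_pt v u)\<^sup>2 \<partial>count_space V)"
    by (auto simp: nn_integral_count_space_indicator intro!: nn_integral_mono split: split_indicator)
  also have "\<dots> = ennreal (C * exp (- (c / 4) * lam)) * (\<integral>\<^sup>+v. (iter u 0 v)\<^sup>2 \<partial>count_space V)"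
    by (simp add: nn_integral_cmult)
  also have "\<dots> \<le> ennreal (C * exp (- (c / 4) * lam)) * (ennreal K ^ Suc 0)\<^sup>2"
    using L2_iter_le[OF u, of 0] by (rule mult_left_mono) simp
  also have "\<dots> = ennreal (C * K\<^sup>2 * exp (- (c / 4) * lam))"
    using C(2) K_pos by (simp add: ennreal_power ennreal_mult[symmetric] ac_simps)
  finally show ?thesis
    using C(2) by (simp add: emeasure_eq_measure)
qed

text \<open>Conditioning divides by a probability of at least \<open>a ^ d\<close>. Once
  \<open>n\<close> is a large enough multiple of \<open>d\<close>, half of the exponential rate pays
  for the division and the other half remains.\<close>

lemma conditional_tail:
  assumes conn: "graph_dist E u v = enat d"
    and q: "0 < pmf q True" and uv: "u \<in> V" "v \<in> V"
    and C: "0 < c" "0 < C" "tail E n u v \<le> ennreal (C * exp (- c * real n))"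
    and n: "(2 * ln (1 / pmf q True) / c + 1) * d \<le> n"
  shows "\<P>(\<omega> in M. enat n \<le> int_dist E \<omega> u v \<bar> v \<in> cluster V E \<omega> u) \<le> C * exp (- (c / 2) * n)"
proof -
  define a where "a = pmf q True"
  have a: "0 < a"
    using q by (simp add: a_def)
  have "two_pt u v = ennreal (prob {\<omega> \<in> space M. v \<in> cluster V E \<omega> u})"
    unfolding two_pt_def tail_def using uv(2)
    by (simp add: cluster_eq emeasure_eq_measure zero_enat_def[symmetric])
  moreover have "ennreal (a ^ d) \<le> two_pt u v"
    unfolding a_def using graph_dist_relpow[OF conn] uv(1) by (rule two_pt_ge)
  ultimately have den: "a ^ d \<le> prob {\<omega> \<in> space M. v \<in> cluster V E \<omega> u}"
    by (simp add: ennreal_le_iff)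
  have "tail E n u v = ennreal (prob {\<omega> \<in> space M. enat n \<le> int_dist E \<omega> u v \<and> v \<in> cluster V E \<omega> u})"
    unfolding tail_def using uv(2) by (simp add: cluster_eq emeasure_eq_measure int_dist_def)
  with C have num: "prob {\<omega> \<in> space M. enat n \<le> int_dist E \<omega> u v \<and> v \<in> cluster V E \<omega> u} \<le>
      C * exp (- c * real n)"
    by (simp add: ennreal_le_iff)
  have "2 * ln (1 / a) / c * d \<le> n"
    using n by (simp add: a_def algebra_simps)
  then have "- (c / 2) * n \<le> d * ln a"
    using C(1) a by (simp add: ln_div field_simps)
  then have "exp (- (c / 2) * n) \<le> exp (d * ln a)"
    by simp
  also have "\<dots> = a ^ d"
    using a by (simp add: exp_of_nat_mult)
  finally have e: "exp (- (c / 2) * n) \<le> a ^ d" .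
  have "\<P>(\<omega> in M. enat n \<le> int_dist E \<omega> u v \<bar> v \<in> cluster V E \<omega> u) \<le>
      C * exp (- c * real n) / a ^ d"
    unfolding cond_prob_def using num den a C(2) by (intro frac_le) auto
  also have "\<dots> = C * exp (- (c / 2) * n) * (exp (- (c / 2) * n) / a ^ d)"
    by (simp add: exp_add[symmetric])
  also have "\<dots> \<le> C * exp (- (c / 2) * n) * 1"
    using e a C(2) by (intro mult_left_mono) auto
  finally show ?thesis by simp
qed

end

section \<open>Common constants for the two estimates\<close>

theorem theorem3p3:
  fixes V :: "'a set" and E :: "'a set set" and p :: real
  assumes "simple_graph V E"
    and "connected_graph V E"
    and "locally_finite_graph V E"
    and "quasi_transitive V E"
    and "0 < p" and "p < p_2_2 V E"
  shows "\<exists>c C lam0 :: real. 0 < c \<and> 0 < C \<and> 0 < lam0 \<and>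
    (\<forall>u\<in>V. \<forall>lam::real. 1 \<le> lam \<longrightarrow>
       \<P>(\<omega> in percolation E p.
          ennreal lam \<le> (SUP v \<in> cluster V E \<omega> u - {u}.
             ennreal_of_enat (int_dist E \<omega> u v) / ennreal_of_enat (graph_dist E u v)))
       \<le> C * exp (- c * lam)) \<and>
    (\<forall>u\<in>V. \<forall>v\<in>V. \<forall>n::nat. ennreal lam0 * ennreal_of_enat (graph_dist E u v) \<le> of_nat n \<longrightarrow>
       \<P>(\<omega> in percolation E p. enat n \<le> int_dist E \<omega> u v \<bar> v \<in> cluster V E \<omega> u)
       \<le> C * exp (- c * real n))"
proof -
  have V: "countable V"
    using assms(1-3) by (rule countable_vertices)
  note p = below_p_2_2[OF V assms(1,3,5,6)]
  interpret bond_percolation V E "bernoulli_pmf p"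
    using assms V by unfold_locales
  have perc: "percolation E p = M"
    by (simp add: percolation_def)
  obtain K where K: "0 < K" "\<And>f. (\<integral>\<^sup>+u. (\<integral>\<^sup>+w. two_point V E p u w * f w \<partial>count_space V)\<^sup>2 \<partial>count_space V) \<le>
      (ennreal K)\<^sup>2 * (\<integral>\<^sup>+w. (f w)\<^sup>2 \<partial>count_space V)"
    using L2_bound_of_op_norm[OF p(2)] by blast
  \<comment> \<open>Clusters are subsets of \<open>V\<close> by definition, so the kernels are
    identified for targets in \<open>V\<close>, which is all that sums over \<open>V\<close>
    see.\<close>
  have two_pt: "two_point V E p u w = two_pt u w" if "w \<in> V" for u w
    using that by (simp add: two_point_eq two_pt_def tail_def zero_enat_def[symmetric])
  interpret L2_bounded_percolation V E "bernoulli_pmf p" K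
  proof
    have eq: "(\<integral>\<^sup>+w. two_pt u w * f w \<partial>count_space V) = (\<integral>\<^sup>+w. two_point V E p u w * f w \<partial>count_space V)"
      for u f
      by (intro nn_integral_cong) (simp add: two_pt)
    show "(\<integral>\<^sup>+u. (\<integral>\<^sup>+w. two_pt u w * f w \<partial>count_space V)\<^sup>2 \<partial>count_space V) \<le>
      (ennreal K)\<^sup>2 * (\<integral>\<^sup>+w. (f w)\<^sup>2 \<partial>count_space V)" for f
      unfolding eq by (rule K(2))
  qed (rule K)
  obtain c C where C: "0 < c" "0 < C"
    "\<And>u v n. u \<in> V \<Longrightarrow> v \<in> V \<Longrightarrow> tail E n u v \<le> ennreal (C * exp (- c * real n))"
    using tail_exponential by blast
  have a: "pmf (bernoulli_pmf p) True = p"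
    using p assms(5) by simp
  have conn: "graph_dist E u v < \<infinity>" if "u \<in> V" "v \<in> V" for u v
    using assms(2) that unfolding graph_dist_finite_iff connected_graph_def by blast
  define lam1 where "lam1 = 8 * ln (1 / p) / c"
  define lam0 where "lam0 = 2 * ln (1 / p) / c + 1"
  have "0 < ln (1 / p)"
    using p assms(5) by simp
  then have lam0: "0 < lam0"
    using C(1) by (simp add: lam0_def add_pos_pos)
  \<comment> \<open>One constant for three cases: the ratio estimate when
    \<open>lam \<ge> lam1\<close>, the ratio estimate when \<open>lam < lam1\<close>, and the
    conditional estimate.\<close>
  define D where "D = C * K\<^sup>2 + exp (c / 4 * lam1) + C"
  have "0 < D"
    using C by (simp add: D_def add_pos_pos add_nonneg_pos)
  have claim1: "\<P>(\<omega> in M. ennreal lam \<le> (SUP v \<in> cluster V E \<omega> u - {u}.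
      ennreal_of_enat (int_dist E \<omega> u v) / ennreal_of_enat (graph_dist E u v)))
    \<le> D * exp (- (c / 4) * lam)" (is "prob ?B \<le> _") if "u \<in> V" "1 \<le> lam" for u lam
  proof (cases "lam1 \<le> lam")
    case True
    have "prob ?B \<le> C * K\<^sup>2 * exp (- (c / 4) * lam)"
      using that True assms(5) C conn by (intro ratio_tail) (simp_all add: a lam1_def)
    also have "\<dots> \<le> D * exp (- (c / 4) * lam)"
      using C by (intro mult_right_mono) (auto simp: D_def)
    finally show ?thesis .
  next
    case False
    \<comment> \<open>Below \<open>lam1\<close> the trivial bound suffices, since
      \<open>exp (c / 4 * (lam1 - lam)) \<ge> 1\<close>.\<close>
    have "prob ?B \<le> 1"
      by (rule prob_le_1)
    also have "\<dots> \<le> exp (c / 4 * lam1) * exp (- (c / 4) * lam)"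
      using False C(1) by (simp add: exp_add[symmetric])
    also have "\<dots> \<le> D * exp (- (c / 4) * lam)"
      using C by (intro mult_right_mono) (auto simp: D_def)
    finally show ?thesis .
  qed
  have claim2: "\<P>(\<omega> in M. enat n \<le> int_dist E \<omega> u v \<bar> v \<in> cluster V E \<omega> u) \<le> D * exp (- (c / 4) * real n)"
    if uv: "u \<in> V" "v \<in> V" and n: "ennreal lam0 * ennreal_of_enat (graph_dist E u v) \<le> of_nat n" for u v n
  proof -
    obtain d where d: "graph_dist E u v = enat d"
      using conn[OF uv] by (cases "graph_dist E u v") auto
    have "ennreal (lam0 * d) \<le> ennreal n"
      using n lam0 by (simp add: d ennreal_of_nat_eq_real_of_nat ennreal_mult)
    then have "lam0 * d \<le> n"
      by (simp add: ennreal_le_iff)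
    then have "\<P>(\<omega> in M. enat n \<le> int_dist E \<omega> u v \<bar> v \<in> cluster V E \<omega> u) \<le> C * exp (- (c / 2) * n)"
      using uv assms(5) C by (intro conditional_tail[OF d]) (simp_all add: a lam0_def)
    \<comment> \<open>The rate \<open>c / 2\<close> is weakened to the rate \<open>c / 4\<close> of
      the ratio estimate.\<close>
    also have "\<dots> \<le> D * exp (- (c / 4) * n)"
      using C by (intro mult_mono) (auto simp: D_def add_nonneg_nonneg)
    finally show ?thesis .
  qed
  show ?thesis
    unfolding perc
    by (intro exI[of _ "c / 4"] exI[of _ D] exI[of _ lam0] conjI ballI allI impI claim1 claim2)
      (use C(1) \<open>0 < D\<close> lam0 in simp_all)
qed

end
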